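(* Let $m\ge 4$ and let $C=C_1\cup\dots\cup C_m\subset\mathbb{P}^2$ be a normal crossing divisor whose irreducible components $C_j:f_j=0$ are smooth curves of degree $e_j$; let $f=f_1\cdots f_m$ and $d=\deg f=e_1+\dots+e_m$, and let $\ell(C)$ be the number of indices $j$ with $e_j=1$. Then the graded $S$-module $D_0(f)$ is generated by the syzygies corresponding to the following set $G$ of homogeneous differential forms in $\Omega^2$. (1) If $\ell(C)=0$, then $G$ consists of the $m-1$ forms $\omega_j$, $j=1,\dots,m-1$, and the three forms $\omega^x,\omega^y,\omega^z$. In particular, the exponents of $C$ are $d_1=\dots=d_{m-1}=d-2$, $d_m=d_{m+1}=d_{m+2}=d-1$. (2) If $\ell(C)=1$, with numbering and coordinates chosen such that $f_1=x$, then $G$ consists of the $m-1$ forms $\omega_j$, $j=1,\dots,m-1$, and the two forms $\omega^y,\omega^z$. In particular, the exponents of $C$ are $d_1=\dots=d_{m-1}=d-2$, $d_m=d_{m+1}=d-1$. (3) If $\ell(C)=2$, with numbering and coordinates chosen such that $f_1=x$ and $f_2=y$, then $G$ consists of the $m-1$ forms $\omega_j$, $j=1,\dots,m-1$, and the form $\omega^z$. In particular, the exponents of $C$ are $d_1=\dots=d_{m-1}=d-2$, $d_m=d-1$. (4) If $\ell(C)\ge 3$, then $G$ consists of the $m-1$ forms $\omega_j$, $j=1,\dots,m-1$. In particular, the exponents of $C$ are $d_1=\dots=d_{m-1}=d-2$.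
   Context: $S=\mathbb{C}[x,y,z]$ with its standard grading, and $\mathbb{P}^2$ is the complex projective plane. For $f\in S$ homogeneous with partial derivatives $f_x,f_y,f_z$, the graded module of Jacobian syzygies is $D_0(f)=\{(a,b,c)\in S^3: af_x+bf_y+cf_z=0\}$; a homogeneous syzygy $(a,b,c)$ has degree equal to the common degree of $a,b,c$. If $D_0(f)$ is minimally generated by $s$ homogeneous syzygies of degrees $d_1\le\dots\le d_s$, these degrees are called the exponents of the curve $C:f=0$. $\Omega^j$ is the $S$-module of polynomial differential $j$-forms on $\mathbb{C}^3$, graded so that $x,y,z,dx,dy,dz$ all have degree $1$. A triple $(a,b,c)\in S^3$ is identified with the 2-form $a\,dy\wedge dz-b\,dx\wedge dz+c\,dx\wedge dy$. Under this identification $(a,b,c)\in D_0(f)$ if and only if the corresponding 2-form $\omega$ satisfies $df\wedge\omega=0$; a syzygy of degree $k$ corresponds to a 2-form of degree $k+2$. Define $\omega^x=df\wedge dx$, $\omega^y=df\wedge dy$, $\omega^z=df\wedge dz$, and for $j=1,\dots,m$ $$\omega_j=df\wedge\frac{df_j}{f_j}=\sum_{1\le i\le m,\ i\ne j}\frac{f}{f_if_j}\,df_i\wedge df_j\in\Omega^2 .$$ *)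

theory Defs
  imports "HOL-Computational_Algebra.Polynomial" "HOL-Library.Product_Plus"
begin

text \<open>
  The ring \<open>S = \<complex>[x,y,z]\<close> is represented as the iterated polynomial ring \<open>\<complex>[x][y][z]\<close>:
  \<open>x\<close> is the innermost and \<open>z\<close> the outermost variable.
\<close>

type_synonym S = "complex poly poly poly"
type_synonym S3 = "S \<times> S \<times> S"
type_synonym point = "complex \<times> complex \<times> complex"

definition xvar :: S where "xvar = [:[:[:0, 1:]:]:]"
definition yvar :: S where "yvar = [:[:0, 1:]:]"
definition zvar :: S where "zvar = [:0, 1:]"

definition homogeneous :: "nat \<Rightarrow> S \<Rightarrow> bool" where
  "homogeneous n p \<longleftrightarrow>
     (\<forall>i j k. coeff (coeff (coeff p k) j) i \<noteq> 0 \<longrightarrow> i + j + k = n)"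

definition partial_x :: "S \<Rightarrow> S" where "partial_x = map_poly (map_poly pderiv)"
definition partial_y :: "S \<Rightarrow> S" where "partial_y = map_poly pderiv"
definition partial_z :: "S \<Rightarrow> S" where "partial_z = pderiv"

fun eval_at :: "S \<Rightarrow> point \<Rightarrow> complex" where
  "eval_at p (a, b, c) = poly (poly (poly p [:[:c:]:]) [:b:]) a"

fun scale3 :: "S \<Rightarrow> S3 \<Rightarrow> S3" where
  "scale3 s (a, b, c) = (s * a, s * b, s * c)"

interpretation S3: module scale3
  by unfold_locales (auto simp: algebra_simps)

subsection \<open>Jacobian syzygies and exponents\<close>

definition D0 :: "S \<Rightarrow> S3 set" where
  "D0 f = {(a, b, c). a * partial_x f + b * partial_y f + c * partial_z f = 0}"

fun homogeneous3 :: "nat \<Rightarrow> S3 \<Rightarrow> bool" where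
  "homogeneous3 n (a, b, c) \<longleftrightarrow> homogeneous n a \<and> homogeneous n b \<and> homogeneous n c"

text \<open>
  \<open>has_exponents f ds\<close>: the module \<open>D0 f\<close> is minimally generated by homogeneous syzygies whose
  degrees, in increasing order, are \<open>ds\<close>.  Minimality means that no generator can be omitted;
  in particular no generator is zero, so that its degree is well defined.
\<close>

definition has_exponents :: "S \<Rightarrow> nat list \<Rightarrow> bool" where
  "has_exponents f ds \<longleftrightarrow> sorted ds \<and>
     (\<exists>rs. length rs = length ds \<and>
        (\<forall>i<length ds. homogeneous3 (ds ! i) (rs ! i)) \<and>
        S3.span (set rs) = D0 f \<and>
        (\<forall>i<length ds. S3.span {rs ! k | k. k < length ds \<and> k \<noteq> i} \<noteq> D0 f))"

subsection \<open>Differential forms\<close>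

text \<open>
  A triple \<open>(a, b, c)\<close> of type \<open>form1\<close> stands for \<open>a dx + b dy + c dz\<close>, and of type \<open>form2\<close> for
  \<open>a dy\<and>dz + b dx\<and>dz + c dx\<and>dy\<close>.  The identification of 2-forms with elements of \<open>S\<^sup>3\<close>,
  \<open>syzygy_of_form\<close>, therefore changes the sign of the middle coefficient.
\<close>

type_synonym form1 = S3
type_synonym form2 = S3

definition ext_d :: "S \<Rightarrow> form1" where
  "ext_d f = (partial_x f, partial_y f, partial_z f)"

fun wedge :: "form1 \<Rightarrow> form1 \<Rightarrow> form2" where
  "wedge (a, b, c) (a', b', c') = (b * c' - c * b', a * c' - c * a', a * b' - b * a')"

fun syzygy_of_form :: "form2 \<Rightarrow> S3" where
  "syzygy_of_form (a, b, c) = (a, - b, c)"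

definition omega_x :: "S \<Rightarrow> form2" where "omega_x f = wedge (ext_d f) (ext_d xvar)"
definition omega_y :: "S \<Rightarrow> form2" where "omega_y f = wedge (ext_d f) (ext_d yvar)"
definition omega_z :: "S \<Rightarrow> form2" where "omega_z f = wedge (ext_d f) (ext_d zvar)"

definition curve_poly :: "nat \<Rightarrow> (nat \<Rightarrow> S) \<Rightarrow> S" where
  "curve_poly m F = (\<Prod>j=1..m. F j)"

text \<open>The division in the following definition is exact.\<close>

definition omega :: "nat \<Rightarrow> (nat \<Rightarrow> S) \<Rightarrow> nat \<Rightarrow> form2" where
  "omega m F j =
     (\<Sum>i\<in>{1..m} - {j}. scale3 (curve_poly m F div (F i * F j)) (wedge (ext_d (F i)) (ext_d (F j))))"

definition generated_by_forms :: "S \<Rightarrow> form2 set \<Rightarrow> bool" where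
  "generated_by_forms f G \<longleftrightarrow> S3.span (syzygy_of_form ` G) = D0 f"

subsection \<open>Smooth curves and normal crossings\<close>

text \<open>Points of the projective plane are given by nonzero representatives in \<open>\<complex>\<^sup>3\<close>.\<close>

definition smooth_curve :: "S \<Rightarrow> bool" where
  "smooth_curve g \<longleftrightarrow>
     (\<forall>p. p \<noteq> (0, 0, 0) \<and> eval_at g p = 0 \<longrightarrow>
        \<not> (eval_at (partial_x g) p = 0 \<and> eval_at (partial_y g) p = 0 \<and> eval_at (partial_z g) p = 0))"

text \<open>
  The components passing through any point have local equations with linearly independent
  differentials in the cotangent space of the plane at that point.  This is tested on the affine
  cone: if a homogeneous \<open>g\<close> vanishes at \<open>p\<close>, its gradient at \<open>p\<close> annihilates \<open>p\<close> by Euler's formula,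
  hence lies in the dual of \<open>\<complex>\<^sup>3/\<complex>p\<close>, which is the cotangent space up to a twist.  Since that space has
  dimension two, at most two components meet at a point, and they do so transversally.
\<close>

definition normal_crossing :: "nat \<Rightarrow> (nat \<Rightarrow> S) \<Rightarrow> bool" where
  "normal_crossing m F \<longleftrightarrow>
     (\<forall>p. p \<noteq> (0, 0, 0) \<longrightarrow>
        (let J = {j \<in> {1..m}. eval_at (F j) p = 0} in
           \<forall>c :: nat \<Rightarrow> complex.
             (\<Sum>j\<in>J. c j * eval_at (partial_x (F j)) p) = 0 \<and>
             (\<Sum>j\<in>J. c j * eval_at (partial_y (F j)) p) = 0 \<and>
             (\<Sum>j\<in>J. c j * eval_at (partial_z (F j)) p) = 0 \<longrightarrow> (\<forall>j\<in>J. c j = 0)))"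

end

theory Submission
  imports
    Defs
    "HOL-Computational_Algebra.Polynomial_Factorial"
    "HOL-Computational_Algebra.Field_as_Ring"
    "HOL-Computational_Algebra.Fundamental_Theorem_Algebra"
    "HOL-Analysis.Continuum_Not_Denumerable"
begin

text \<open>
  Triples over \<open>S\<close> are treated as vectors.  Under the identification of forms with triples the wedge
  product of one-forms becomes the cross product, \<open>D0 f\<close> consists of the \<open>s\<close> orthogonal to \<open>grad f\<close>, and
  contraction with the Euler field becomes the cross product with \<open>r = (x, y, z)\<close>.

  To generate a syzygy \<open>s\<close>, put \<open>\<beta> = s \<times> r\<close>.  Euler's formula gives \<open>grad f \<times> \<beta> = d f s\<close>, so it is
  enough to show that the logarithmic one-form \<open>\<beta>/f\<close> is a combination of the \<open>df\<^sub>j/f\<^sub>j\<close> plus a polynomial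
  form (\<open>logarithmic_form_decomposition\<close>); taking the product with \<open>df\<close> then expresses \<open>s\<close> by the
  \<open>\<omega>\<^sub>j\<close> and \<open>\<omega>\<^sup>x, \<omega>\<^sup>y, \<omega>\<^sup>z\<close> (\<open>syzygy_decomposition\<close>).  Restricted to \<open>f\<^sub>j = 0\<close> the form \<open>\<beta>\<close> is parallel
  to \<open>df\<^sub>j\<close>, and smoothness makes it a polynomial multiple \<open>c\<^sub>j df\<^sub>j\<close>.  The restrictions agree where two
  components meet, and since these meet transversally, \<open>c\<^sub>j\<close> must vanish there: \<open>c\<^sub>j \<in> (f\<^sub>i, f\<^sub>j)\<close>.  Since no
  three components meet, \<open>c\<^sub>j\<close> is modulo \<open>f\<^sub>j\<close> a multiple of the product of all other \<open>f\<^sub>i\<close>, which means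
  that \<open>\<beta>/f\<close> has a polynomial residue.

  The geometric hypotheses enter through one statement (\<open>saturation\<close>) on homogeneous \<open>F\<close>, \<open>G\<close>: if
  homogeneous polynomials without a common zero on \<open>F = G = 0\<close> in the plane multiply \<open>c\<close> into
  \<open>(F, G)\<close>, with \<open>F\<close> prime and not dividing \<open>G\<close>, then \<open>c \<in> (F, G)\<close>.  It combines the weak
  Nullstellensatz with the fact that \<open>(F, G)\<close> has no embedded component at the origin, for which the
  Koszul relations suffice.

  The sum of all \<open>\<omega>\<^sub>j\<close> is zero, so \<open>\<omega>\<^sub>m\<close> may be omitted; and \<open>f\<^sub>j \<omega>\<^sub>j = df \<and> df\<^sub>j\<close>, so every linear \<open>f\<^sub>j\<close>
  makes one of the constant directions superfluous.  By normal crossings the gradients of up to three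
  lines are linearly independent.

  The generating sets are minimal because a relation \<open>\<Sum> a\<^sub>j \<omega>\<^sub>j + df \<and> \<tau> = 0\<close> forces
  \<open>a\<^sub>j = h + f\<^sub>j k\<^sub>j\<close> and \<open>\<Sum> k\<^sub>j df\<^sub>j + \<tau> = 0\<close>, again by contraction with the Euler field and comparison of
  residues (\<open>relation_structure\<close>).  At the origin all \<open>f\<^sub>j\<close> vanish, and so do the \<open>df\<^sub>j\<close> of the
  components that are not lines.  With \<open>a\<^sub>m = 0\<close> and
  \<open>\<tau>\<close> a combination of directions independent of the lines, all coefficients of the relation vanish at
  the origin, so none of them is a nonzero constant and no generator can be omitted.
\<close>

section \<open>Polynomials in three variables\<close>

lemma irreducible_S_imp_prime_elem:
  fixes p :: S
  assumes "irreducible p"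
  shows "prime_elem p"
  using assms by (rule irreducible_imp_prime_elem)

definition scalar :: "complex \<Rightarrow> S" where "scalar a = [:[:[:a:]:]:]"

lemma scalar_simps [simp]:
  "scalar 0 = 0" "scalar 1 = 1"
  "scalar (a + b) = scalar a + scalar b"
  "scalar (a * b) = scalar a * scalar b"
  "scalar (a - b) = scalar a - scalar b"
  "scalar (- a) = - scalar a"
  by (simp_all add: scalar_def one_pCons)

lemma scalar_eq_iff [simp]: "scalar a = scalar b \<longleftrightarrow> a = b"
  by (simp add: scalar_def)

lemma scalar_eq_0_iff [simp]: "scalar a = 0 \<longleftrightarrow> a = 0"
  by (simp add: scalar_def)

lemma scalar_of_nat: "scalar (of_nat n) = of_nat n"
  by (induction n) auto

definition monomial :: "complex \<Rightarrow> nat \<Rightarrow> nat \<Rightarrow> nat \<Rightarrow> S" where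
  "monomial a i j k = monom (monom (monom a i) j) k"

lemma monomial_conv: "monomial a i j k = scalar a * xvar ^ i * yvar ^ j * zvar ^ k"
proof -
  have 1: "monom (p :: 'a :: comm_semiring_1) k = [:p:] * [:0, 1:] ^ k" for p k
    by (simp add: monom_altdef)
  have 2: "[:p * q:] = [:p:] * [:q:]" for p q :: "'a :: comm_semiring_1"
    by (simp add: mult.commute)
  have 3: "[:p ^ n:] = [:p:] ^ n" for p :: "'a :: comm_semiring_1" and n
  proof (induction n)
    case (Suc n)
    then show ?case by (simp add: mult.commute flip: Suc)
  qed (simp add: one_pCons)
  show ?thesis
    unfolding monomial_def scalar_def xvar_def yvar_def zvar_def 1 2 3 by (simp add: mult.assoc)
qed

lemma S_expansion:
  fixes p :: S
  shows "p = (\<Sum>k\<le>degree p. \<Sum>j\<le>degree (coeff p k). \<Sum>i\<le>degree (coeff (coeff p k) j).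
               monomial (coeff (coeff (coeff p k) j) i) i j k)"
  unfolding monomial_def
  by (subst poly_as_sum_of_monoms[symmetric], subst (2) poly_as_sum_of_monoms[symmetric],
      subst (3) poly_as_sum_of_monoms[symmetric]) (simp add: monom_sum)

lemma S_induct_monomial [case_names zero add monomial]:
  fixes p :: S
  assumes "P 0" and "\<And>p q. P p \<Longrightarrow> P q \<Longrightarrow> P (p + q)" and "\<And>a i j k. P (monomial a i j k)"
  shows "P p"
proof -
  have sum: "P (sum f A)" if "finite A" "\<And>x. x \<in> A \<Longrightarrow> P (f x)" for f :: "nat \<Rightarrow> S" and A
    using that by (induction A rule: finite_induct) (auto intro: assms)
  show ?thesis
    by (subst S_expansion) (intro sum finite_atMost assms)
qed

lemma S_induct [case_names scalar x y z add mult]: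
  fixes p :: S
  assumes "\<And>a. P (scalar a)" and "P xvar" and "P yvar" and "P zvar"
    and "\<And>p q. P p \<Longrightarrow> P q \<Longrightarrow> P (p + q)" and "\<And>p q. P p \<Longrightarrow> P q \<Longrightarrow> P (p * q)"
  shows "P p"
proof -
  have power: "P (q ^ n)" if "P q" for q n
  proof (induction n)
    case 0
    show ?case using assms(1)[of 1] by simp
  next
    case (Suc n)
    then show ?case using that by (auto intro: assms)
  qed
  show ?thesis
  proof (induction p rule: S_induct_monomial)
    case zero
    show ?case using assms(1)[of 0] by simp
  next
    case (monomial a i j k)
    show ?case
      unfolding monomial_conv by (intro assms power)
  qed (fact assms)
qed

subsection \<open>Substitution homomorphisms\<close>

definition ring_hom :: "('a :: comm_ring_1 \<Rightarrow> 'b :: comm_ring_1) \<Rightarrow> bool" where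
  "ring_hom h \<longleftrightarrow> h 1 = 1 \<and> (\<forall>a b. h (a + b) = h a + h b) \<and> (\<forall>a b. h (a * b) = h a * h b)"

lemma ring_hom_simps:
  assumes "ring_hom h"
  shows "h 0 = 0" "h 1 = 1" "h (a + b) = h a + h b" "h (a * b) = h a * h b"
    "h (- a) = - h a" "h (a - b) = h a - h b" "h (a ^ n) = h a ^ n"
proof -
  show add: "h (a + b) = h a + h b" and mult: "h (a * b) = h a * h b" and one: "h 1 = 1" for a b
    using assms unfolding ring_hom_def by blast+
  show zero: "h 0 = 0"
    using add[of 0 0] by simp
  show minus: "h (- a) = - h a" for a
    using add[of a "- a"] zero by (simp add: eq_neg_iff_add_eq_0 add.commute)
  show "h (a - b) = h a - h b"
    using add[of a "- b"] minus by simp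
  show "h (a ^ n) = h a ^ n"
    by (induction n) (simp_all add: one mult)
qed

lemma ring_hom_sum:
  assumes "ring_hom h"
  shows "h (sum f A) = (\<Sum>i\<in>A. h (f i))"
  by (induction A rule: infinite_finite_induct) (simp_all add: ring_hom_simps[OF assms])

lemma ring_hom_poly_map_poly:
  assumes h: "ring_hom h"
  shows "ring_hom (\<lambda>p. poly (map_poly h p) X)"
proof -
  note [simp] = ring_hom_simps[OF h]
  have add: "poly (map_poly h (p + q)) X = poly (map_poly h p) X + poly (map_poly h q) X" for p q
  proof -
    have "map_poly h (p + q) = map_poly h p + map_poly h q"
      by (rule poly_eqI) (simp add: coeff_map_poly)
    then show ?thesis by simp
  qed
  have smult: "poly (map_poly h (smult a q)) X = h a * poly (map_poly h q) X" for a q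
    by (simp add: map_poly_smult)
  have mult: "poly (map_poly h (p * q)) X = poly (map_poly h p) X * poly (map_poly h q) X" for p q
    by (induction p) (simp_all add: add smult map_poly_pCons algebra_simps)
  show ?thesis
    unfolding ring_hom_def by (simp add: add mult)
qed

definition subst ::
    "(complex \<Rightarrow> 'b :: comm_ring_1) \<Rightarrow> 'b \<Rightarrow> 'b \<Rightarrow> 'b \<Rightarrow> S \<Rightarrow> 'b" where
  "subst \<kappa> X Y Z = (\<lambda>p. poly (map_poly (\<lambda>q. poly (map_poly (\<lambda>r. poly (map_poly \<kappa> r) X) q) Y) p) Z)"

lemma ring_hom_subst:
  assumes "ring_hom \<kappa>"
  shows "ring_hom (subst \<kappa> X Y Z)"
  unfolding subst_def by (intro ring_hom_poly_map_poly assms)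

lemma subst_generators [simp]:
  assumes "ring_hom \<kappa>"
  shows "subst \<kappa> X Y Z (scalar a) = \<kappa> a" "subst \<kappa> X Y Z xvar = X"
    "subst \<kappa> X Y Z yvar = Y" "subst \<kappa> X Y Z zvar = Z"
  using ring_hom_simps[OF assms]
  by (simp_all add: subst_def scalar_def xvar_def yvar_def zvar_def map_poly_pCons one_pCons)

lemma ring_hom_scalar: "ring_hom scalar"
  by (simp add: ring_hom_def)

lemma ring_hom_eval_at: "ring_hom (\<lambda>p. eval_at p P)"
  by (cases P) (simp add: ring_hom_def)

lemma eval_at_simps [simp]:
  "eval_at 0 P = 0" "eval_at 1 P = 1"
  "eval_at (p + q) P = eval_at p P + eval_at q P"
  "eval_at (p * q) P = eval_at p P * eval_at q P"
  "eval_at (- p) P = - eval_at p P"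
  "eval_at (p - q) P = eval_at p P - eval_at q P"
  "eval_at (p ^ n) P = eval_at p P ^ n"
  using ring_hom_simps[OF ring_hom_eval_at] by simp_all

lemma eval_at_generators [simp]:
  "eval_at (scalar s) P = s" "eval_at xvar (a, b, c) = a"
  "eval_at yvar (a, b, c) = b" "eval_at zvar (a, b, c) = c"
  by (cases P; simp add: scalar_def xvar_def yvar_def zvar_def)+

lemma eval_at_sum [simp]: "eval_at (sum f A) P = (\<Sum>i\<in>A. eval_at (f i) P)"
  by (rule ring_hom_sum[OF ring_hom_eval_at])

declare eval_at.simps [simp del]

subsection \<open>The grading\<close>

text \<open>
The substitution \<open>p(x, y, z) \<mapsto> p(tx, ty, tz)\<close>, with \<open>t\<close> the variable of \<open>S poly\<close>.  The coefficient of
\<open>t\<^sup>n\<close> is the homogeneous component of degree \<open>n\<close>.  As the substitution is a ring homomorphism, the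
behaviour of components under products comes for free.
\<close>

definition grade :: "S \<Rightarrow> S poly" where
  "grade = subst (\<lambda>a. [:scalar a:]) (monom xvar 1) (monom yvar 1) (monom zvar 1)"

abbreviation component :: "nat \<Rightarrow> S \<Rightarrow> S" where
  "component n p \<equiv> coeff (grade p) n"

lemma ring_hom_grade: "ring_hom grade"
  and ring_hom_scalar_const: "ring_hom (\<lambda>a. [:scalar a:])"
proof -
  show *: "ring_hom (\<lambda>a. [:scalar a:])"
    by (simp add: ring_hom_def one_pCons)
  show "ring_hom grade"
    unfolding grade_def by (rule ring_hom_subst[OF *])
qed

lemmas grade_simps [simp] = ring_hom_simps[OF ring_hom_grade] ring_hom_sum[OF ring_hom_grade]

lemma grade_monomial: "grade (monomial a i j k) = monom (monomial a i j k) (i + j + k)"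
proof -
  have "grade (monomial a i j k) = [:scalar a:] * monom xvar 1 ^ i * monom yvar 1 ^ j * monom zvar 1 ^ k"
    unfolding monomial_conv grade_simps unfolding grade_def
    by (simp only: subst_generators[OF ring_hom_scalar_const])
  also have "[:scalar a:] = monom (scalar a) 0"
    by (simp add: monom_0)
  finally show ?thesis
    by (simp add: monom_power mult_monom monomial_conv)
qed

lemma coeff_monomial:
  "coeff (coeff (coeff (monomial a i j k) k') j') i' = (if i = i' \<and> j = j' \<and> k = k' then a else 0)"
  by (simp add: monomial_def)

lemma homogeneous_add:
  "homogeneous n p \<Longrightarrow> homogeneous n q \<Longrightarrow> homogeneous n (p + q)"
  unfolding homogeneous_def by (metis coeff_add add_0)

lemma homogeneous_0 [simp]: "homogeneous n 0"
  by (simp add: homogeneous_def)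

lemma homogeneous_component: "homogeneous n (component n p)"
proof (induction p rule: S_induct_monomial)
  case (monomial a i j k)
  then show ?case by (auto simp: grade_monomial homogeneous_def coeff_monomial)
qed (auto intro: homogeneous_add)

lemma sum_components: "(\<Sum>n\<le>degree (grade p). component n p) = p"
proof -
  have "poly (grade p) 1 = p"
    by (induction p rule: S_induct_monomial) (simp_all add: grade_monomial poly_monom)
  then show ?thesis
    by (simp add: poly_altdef)
qed

lemma homogeneous_iff_grade: "homogeneous n p \<longleftrightarrow> grade p = monom p n"
proof
  assume hom: "homogeneous n p"
  define t where "t k j i = monomial (coeff (coeff (coeff p k) j) i) i j k" for i j k
  have t: "grade (t k j i) = monom (t k j i) n" for i j k
  proof (cases "coeff (coeff (coeff p k) j) i = 0")
    case True
    then show ?thesis by (simp add: t_def monomial_def)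
  next
    case False
    then show ?thesis
      using hom by (simp add: t_def homogeneous_def grade_monomial)
  qed
  have p: "p = (\<Sum>k\<le>degree p. \<Sum>j\<le>degree (coeff p k). \<Sum>i\<le>degree (coeff (coeff p k) j). t k j i)"
    unfolding t_def by (rule S_expansion)
  show "grade p = monom p n"
    by (subst p, subst (2) p) (simp add: t monom_sum)
next
  assume "grade p = monom p n"
  then have "component n p = p"
    by simp
  then show "homogeneous n p"
    using homogeneous_component[of n p] by simp
qed

lemma homogeneous_mult:
  "homogeneous m p \<Longrightarrow> homogeneous n q \<Longrightarrow> homogeneous (m + n) (p * q)"
  by (simp add: homogeneous_iff_grade mult_monom)

lemma homogeneous_1: "homogeneous 0 1"
  by (simp add: homogeneous_iff_grade monom_0)

lemma homogeneous_prod: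
  assumes "\<And>i. i \<in> A \<Longrightarrow> homogeneous (e i) (g i)"
  shows "homogeneous (sum e A) (prod g A)"
  using assms
  by (induction A rule: infinite_finite_induct) (auto simp: homogeneous_1 intro: homogeneous_mult)

lemma homogeneous_uminus: "homogeneous n p \<Longrightarrow> homogeneous n (- p)"
  by (simp add: homogeneous_def)

lemma homogeneous_diff:
  "homogeneous n p \<Longrightarrow> homogeneous n q \<Longrightarrow> homogeneous n (p - q)"
  using homogeneous_add[of n p "- q"] homogeneous_uminus by simp

lemma homogeneous_xyz: "homogeneous 1 xvar" "homogeneous 1 yvar" "homogeneous 1 zvar"
  unfolding homogeneous_iff_grade unfolding grade_def
  by (simp_all only: subst_generators[OF ring_hom_scalar_const])

lemma component_homogeneous_mult:
  assumes "homogeneous k h"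
  shows "component (k + n) (h * p) = h * component n p"
  using assms by (simp add: homogeneous_iff_grade coeff_monom_mult)

lemma homogeneous_degree_0:
  assumes "homogeneous 0 p"
  obtains a where "p = scalar a"
proof
  show "p = scalar (coeff (coeff (coeff p 0) 0) 0)"
    using assms
    by (intro poly_eqI) (auto simp: scalar_def homogeneous_def coeff_pCons split: nat.splits)
qed

lemma eval_at_origin_homogeneous:
  assumes "homogeneous n p" and "n > 0"
  shows "eval_at p (0, 0, 0) = 0"
  using assms by (force simp: homogeneous_def poly_0_coeff_0 eval_at.simps)

subsection \<open>Partial derivatives\<close>

definition derivation :: "('a :: comm_ring_1 \<Rightarrow> 'a) \<Rightarrow> bool" where
  "derivation D \<longleftrightarrow> (\<forall>a b. D (a + b) = D a + D b) \<and> (\<forall>a b. D (a * b) = a * D b + b * D a)"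

lemma derivation_0: "derivation D \<Longrightarrow> D 0 = 0"
  unfolding derivation_def by (metis add_cancel_right_right)

lemma derivation_map_poly:
  fixes D :: "'a :: comm_ring_1 \<Rightarrow> 'a"
  assumes D: "derivation D"
  shows "derivation (map_poly D)"
proof -
  have D0 [simp]: "D 0 = 0"
    by (rule derivation_0[OF D])
  have [simp]: "D (a + b) = D a + D b" "D (a * b) = a * D b + b * D a" for a b
    using D by (auto simp: derivation_def)
  have add: "map_poly D (p + q) = map_poly D p + map_poly D q" for p q
    by (rule poly_eqI) (simp add: coeff_map_poly)
  have smult: "map_poly D (smult a q) = smult a (map_poly D q) + smult (D a) q" for a q
    by (rule poly_eqI) (simp add: coeff_map_poly algebra_simps)
  have "map_poly D (p * q) = p * map_poly D q + q * map_poly D p" for p q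
    by (induction p) (simp_all add: add smult map_poly_pCons algebra_simps)
  then show ?thesis
    by (simp add: derivation_def add)
qed

lemma derivation_partial:
  "derivation partial_x" "derivation partial_y" "derivation partial_z"
proof -
  have *: "derivation (pderiv :: 'a :: idom poly \<Rightarrow> _)"
    by (simp add: derivation_def pderiv_add pderiv_mult)
  show "derivation partial_x" "derivation partial_y" "derivation partial_z"
    unfolding partial_x_def partial_y_def partial_z_def by (intro derivation_map_poly *)+
qed

lemma partial_add [simp]:
  "partial_x (p + q) = partial_x p + partial_x q"
  "partial_y (p + q) = partial_y p + partial_y q"
  "partial_z (p + q) = partial_z p + partial_z q"
  and partial_mult [simp]:
  "partial_x (p * q) = p * partial_x q + q * partial_x p"
  "partial_y (p * q) = p * partial_y q + q * partial_y p"
  "partial_z (p * q) = p * partial_z q + q * partial_z p"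
  and partial_0 [simp]: "partial_x 0 = 0" "partial_y 0 = 0" "partial_z 0 = 0"
  using derivation_partial derivation_0 by (auto simp: derivation_def)

lemma coeff_partial:
  "coeff (coeff (coeff (partial_x p) k) j) i = of_nat (Suc i) * coeff (coeff (coeff p k) j) (Suc i)"
  "coeff (coeff (coeff (partial_y p) k) j) i = of_nat (Suc j) * coeff (coeff (coeff p k) (Suc j)) i"
  "coeff (coeff (coeff (partial_z p) k) j) i = of_nat (Suc k) * coeff (coeff (coeff p (Suc k)) j) i"
proof -
  have of_nat_mult_coeff: "coeff (of_nat n * q) i = of_nat n * coeff q i"
    for n i and q :: "'a :: comm_ring_1 poly"
    by (simp add: of_nat_poly)
  show "coeff (coeff (coeff (partial_x p) k) j) i = of_nat (Suc i) * coeff (coeff (coeff p k) j) (Suc i)"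
    "coeff (coeff (coeff (partial_y p) k) j) i = of_nat (Suc j) * coeff (coeff (coeff p k) (Suc j)) i"
    "coeff (coeff (coeff (partial_z p) k) j) i = of_nat (Suc k) * coeff (coeff (coeff p (Suc k)) j) i"
    unfolding partial_x_def partial_y_def partial_z_def
    by (simp_all add: coeff_map_poly coeff_pderiv of_nat_mult_coeff del: of_nat_Suc)
qed

lemma homogeneous_partial:
  assumes "homogeneous n p"
  shows "homogeneous (n - 1) (partial_x p)" "homogeneous (n - 1) (partial_y p)"
    "homogeneous (n - 1) (partial_z p)"
  using assms unfolding homogeneous_def coeff_partial
  by (metis add_Suc add_Suc_right diff_Suc_1 mult_zero_right)+

lemma euler_monomial:
  "xvar * partial_x (monomial a i j k) + yvar * partial_y (monomial a i j k)
     + zvar * partial_z (monomial a i j k) = of_nat (i + j + k) * monomial a i j k"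
proof -
  have p0: "partial_x (scalar a) = 0" "partial_y (scalar a) = 0" "partial_z (scalar a) = 0" for a
    by (simp_all add: partial_x_def partial_y_def partial_z_def scalar_def map_poly_pCons)
  have p1: "partial_x 1 = 0" "partial_y 1 = 0" "partial_z 1 = 0"
    using p0[of 1] by simp_all
  have pv: "partial_x xvar = 1" "partial_y xvar = 0" "partial_z xvar = 0"
    "partial_x yvar = 0" "partial_y yvar = 1" "partial_z yvar = 0"
    "partial_x zvar = 0" "partial_y zvar = 0" "partial_z zvar = 1"
    by (simp_all add: partial_x_def partial_y_def partial_z_def xvar_def yvar_def zvar_def
        map_poly_pCons pderiv_pCons one_pCons)
  have px: "xvar * partial_x (xvar ^ n) = of_nat n * xvar ^ n"
    "partial_y (xvar ^ n) = 0" "partial_z (xvar ^ n) = 0" for n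
    by (induction n) (simp_all add: p1 pv algebra_simps)
  have py: "yvar * partial_y (yvar ^ n) = of_nat n * yvar ^ n"
    "partial_x (yvar ^ n) = 0" "partial_z (yvar ^ n) = 0" for n
    by (induction n) (simp_all add: p1 pv algebra_simps)
  have pz: "zvar * partial_z (zvar ^ n) = of_nat n * zvar ^ n"
    "partial_x (zvar ^ n) = 0" "partial_y (zvar ^ n) = 0" for n
    by (induction n) (simp_all add: p1 pv algebra_simps)
  define c where "c = scalar a"
  define X where "X = xvar ^ i"
  define Y where "Y = yvar ^ j"
  define Z where "Z = zvar ^ k"
  have "xvar * partial_x (c * X * Y * Z) + yvar * partial_y (c * X * Y * Z)
     + zvar * partial_z (c * X * Y * Z)
     = c * Y * Z * (xvar * partial_x X) + c * X * Z * (yvar * partial_y Y)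
       + c * X * Y * (zvar * partial_z Z)"
    using p0[of a] px(2,3)[of i] py(2,3)[of j] pz(2,3)[of k]
    by (simp add: c_def[symmetric] X_def[symmetric] Y_def[symmetric] Z_def[symmetric] algebra_simps)
  also have "\<dots> = of_nat (i + j + k) * (c * X * Y * Z)"
    using px(1)[of i] py(1)[of j] pz(1)[of k]
    by (simp add: X_def Y_def Z_def algebra_simps)
  finally show ?thesis
    by (simp add: monomial_conv c_def X_def Y_def Z_def)
qed

lemma euler:
  assumes "homogeneous n p"
  shows "xvar * partial_x p + yvar * partial_y p + zvar * partial_z p = of_nat n * p"
proof -
  define E where "E p = xvar * partial_x p + yvar * partial_y p + zvar * partial_z p" for p
  have E_add: "E (p + q) = E p + E q" for p q
    by (simp add: E_def algebra_simps)
  have "E (component n p) = of_nat n * component n p"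
  proof (induction p rule: S_induct_monomial)
    case (monomial a i j k)
    show ?case
      using euler_monomial[of a i j k]
      by (cases "n = i + j + k") (simp_all add: grade_monomial E_def)
  qed (simp_all add: E_add distrib_left, simp add: E_def)
  then show ?thesis
    using assms by (simp add: homogeneous_iff_grade E_def)
qed

section \<open>The Nullstellensatz\<close>

definition is_ideal :: "S set \<Rightarrow> bool" where
  "is_ideal I \<longleftrightarrow> 0 \<in> I \<and> (\<forall>p\<in>I. \<forall>q\<in>I. p + q \<in> I) \<and> (\<forall>p\<in>I. \<forall>s. s * p \<in> I)"

lemma is_idealD:
  assumes "is_ideal I"
  shows "0 \<in> I" "p \<in> I \<Longrightarrow> q \<in> I \<Longrightarrow> p + q \<in> I" "p \<in> I \<Longrightarrow> s * p \<in> I"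
    "p \<in> I \<Longrightarrow> p * s \<in> I" "p \<in> I \<Longrightarrow> - p \<in> I" "p \<in> I \<Longrightarrow> q \<in> I \<Longrightarrow> p - q \<in> I"
proof -
  show *: "0 \<in> I" "p \<in> I \<Longrightarrow> q \<in> I \<Longrightarrow> p + q \<in> I" "p \<in> I \<Longrightarrow> s * p \<in> I" for p q s
    using assms by (auto simp: is_ideal_def)
  then show "p \<in> I \<Longrightarrow> p * s \<in> I"
    by (simp add: mult.commute)
  show minus: "p \<in> I \<Longrightarrow> - p \<in> I" for p
    using *(3)[of p "- 1"] by simp
  show "p \<in> I \<Longrightarrow> q \<in> I \<Longrightarrow> p - q \<in> I"
    using *(2)[of p "- q"] minus by simp
qed

lemma is_ideal_sum:
  "is_ideal I \<Longrightarrow> (\<And>i. i \<in> A \<Longrightarrow> g i \<in> I) \<Longrightarrow> sum g A \<in> I"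
  by (induction A rule: infinite_finite_induct) (auto intro: is_idealD)

text \<open>
A nonzero scalar is a unit, so a proper ideal contains none.
\<close>

lemma scalar_in_ideal_iff:
  assumes I: "is_ideal I" and one: "1 \<notin> I"
  shows "scalar a \<in> I \<longleftrightarrow> a = 0"
proof
  assume a: "scalar a \<in> I"
  show "a = 0"
  proof (rule ccontr)
    assume "a \<noteq> 0"
    then have "1 = scalar (inverse a * a)"
      by (simp del: scalar_simps(4))
    also have "\<dots> = scalar (inverse a) * scalar a"
      by (rule scalar_simps)
    also have "\<dots> \<in> I"
      by (rule is_idealD(3)[OF I a])
    finally show False using one by simp
  qed
qed (simp add: is_idealD(1)[OF I])

definition adjoin :: "S set \<Rightarrow> S \<Rightarrow> S set" where
  "adjoin I p = {q + s * p | q s. q \<in> I}"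

lemma adjoin:
  assumes I: "is_ideal I"
  shows "is_ideal (adjoin I p)" "I \<subseteq> adjoin I p" "p \<in> adjoin I p"
proof -
  have add: "a + b \<in> adjoin I p" if ab: "a \<in> adjoin I p" "b \<in> adjoin I p" for a b
  proof -
    obtain q s q' s' where "a = q + s * p" "b = q' + s' * p" "q \<in> I" "q' \<in> I"
      using ab unfolding adjoin_def by blast
    then have "a + b = (q + q') + (s + s') * p" "q + q' \<in> I"
      using is_idealD(2)[OF I] by (auto simp: algebra_simps)
    then show ?thesis unfolding adjoin_def by blast
  qed
  have mult: "t * a \<in> adjoin I p" if a: "a \<in> adjoin I p" for a t
  proof -
    obtain q s where "a = q + s * p" "q \<in> I"
      using a unfolding adjoin_def by blast
    then have "t * a = t * q + (t * s) * p" "t * q \<in> I"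
      using is_idealD(3)[OF I] by (auto simp: algebra_simps)
    then show ?thesis unfolding adjoin_def by blast
  qed
  show sub: "I \<subseteq> adjoin I p"
  proof
    fix q assume "q \<in> I"
    then show "q \<in> adjoin I p"
      unfolding adjoin_def by (intro CollectI exI[of _ q] exI[of _ 0]) simp
  qed
  show "p \<in> adjoin I p"
    unfolding adjoin_def using is_idealD(1)[OF I]
    by (intro CollectI exI[of _ 0] exI[of _ 1]) simp
  show "is_ideal (adjoin I p)"
    using add mult sub is_idealD(1)[OF I] by (auto simp: is_ideal_def)
qed

definition maximal_ideal :: "S set \<Rightarrow> bool" where
  "maximal_ideal M \<longleftrightarrow> is_ideal M \<and> 1 \<notin> M \<and>
     (\<forall>I. is_ideal I \<longrightarrow> 1 \<notin> I \<longrightarrow> M \<subseteq> I \<longrightarrow> I = M)"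

lemma exists_maximal_ideal:
  assumes "is_ideal I" and "1 \<notin> I"
  obtains M where "maximal_ideal M" and "I \<subseteq> M"
proof -
  define A where "A = {K. is_ideal K \<and> 1 \<notin> K \<and> I \<subseteq> K}"
  have "\<exists>M\<in>A. \<forall>K\<in>A. M \<subseteq> K \<longrightarrow> K = M"
  proof (rule subset_Zorn_nonempty)
    show "A \<noteq> {}"
      using assms by (auto simp: A_def)
  next
    fix \<C> assume nonempty: "\<C> \<noteq> {}" and chain: "subset.chain A \<C>"
    have ideal: "is_ideal K" if "K \<in> \<C>" for K
      using that chain by (auto simp: subset.chain_def A_def)
    have "p + q \<in> \<Union>\<C>" if pq: "p \<in> \<Union>\<C>" "q \<in> \<Union>\<C>" for p q
    proof -
      obtain K L where KL: "K \<in> \<C>" "L \<in> \<C>" "p \<in> K" "q \<in> L"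
        using pq by blast
      then have "K \<subseteq> L \<or> L \<subseteq> K"
        using chain by (auto simp: subset.chain_def)
      then show ?thesis
        using KL is_idealD(2)[OF ideal] by blast
    qed
    moreover have "s * p \<in> \<Union>\<C>" if "p \<in> \<Union>\<C>" for p s
      using that is_idealD(3)[OF ideal] by blast
    moreover have "0 \<in> \<Union>\<C>"
      using nonempty is_idealD(1)[OF ideal] by blast
    ultimately have "is_ideal (\<Union>\<C>)"
      by (auto simp: is_ideal_def)
    then show "\<Union>\<C> \<in> A"
      using nonempty chain by (auto simp: subset.chain_def A_def)
  qed
  then obtain M where M: "M \<in> A" "\<And>K. K \<in> A \<Longrightarrow> M \<subseteq> K \<Longrightarrow> K = M"
    by blast
  show ?thesis
  proof
    show "I \<subseteq> M"
      using M(1) by (auto simp: A_def)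
    then show "maximal_ideal M"
      using M by (auto simp: maximal_ideal_def A_def)
  qed
qed

lemma maximal_ideal_inverse:
  assumes M: "maximal_ideal M" and p: "p \<notin> M"
  obtains g where "g * p - 1 \<in> M"
proof -
  have I: "is_ideal M"
    using M by (simp add: maximal_ideal_def)
  have "1 \<in> adjoin M p"
    using M adjoin[OF I, of p] p unfolding maximal_ideal_def by metis
  then obtain q s where qs: "1 = q + s * p" "q \<in> M"
    by (auto simp: adjoin_def)
  then have "s * p - 1 = - q"
    by (simp add: algebra_simps)
  then show ?thesis
    using that[of s] is_idealD(5)[OF I qs(2)] by simp
qed

lemma maximal_ideal_prime:
  assumes M: "maximal_ideal M" and pq: "p * q \<in> M" and p: "p \<notin> M"
  shows "q \<in> M"
proof -
  have I: "is_ideal M"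
    using M by (simp add: maximal_ideal_def)
  obtain g where g: "g * p - 1 \<in> M"
    using maximal_ideal_inverse[OF M p] .
  have "q = g * (p * q) - (g * p - 1) * q"
    by (simp add: algebra_simps)
  then show ?thesis
    using is_idealD[OF I] g pq by metis
qed

interpretation S: vector_space "\<lambda>a p. scalar a * p"
  by unfold_locales (auto simp: algebra_simps)

lemma S_countable_span:
  obtains B :: "S set" where "countable B" and "S.span B = UNIV"
proof
  let ?B = "(\<lambda>(i, j, k). xvar ^ i * yvar ^ j * zvar ^ k) ` UNIV"
  show "countable ?B"
    by simp
  have "p \<in> S.span ?B" for p
  proof (induction p rule: S_induct_monomial)
    case (monomial a i j k)
    have "xvar ^ i * yvar ^ j * zvar ^ k \<in> ?B"
      by (rule image_eqI[of _ _ "(i, j, k)"]) auto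
    then show ?case
      using S.span_scale[OF S.span_base] by (simp add: monomial_conv mult.assoc)
  qed (auto intro: S.span_add S.span_zero)
  then show "S.span ?B = UNIV"
    by blast
qed

text \<open>
\<open>S\<close> is the union of the countably many finite-dimensional spaces spanned by the first \<open>n\<close> elements of
a countable spanning set, and an independent set meets each of them in a finite set.
\<close>

lemma S_independent_countable:
  assumes indep: "S.independent A"
  shows "countable A"
proof -
  obtain B :: "S set" where B: "countable B" "S.span B = UNIV"
    by (rule S_countable_span)
  have nonempty: "B \<noteq> {}"
  proof
    assume "B = {}"
    then have "(1 :: S) \<in> {0}" using B(2) by auto
    then show False by simp
  qed
  define b where "b = from_nat_into B"
  have b: "range b = B"
    using B(1) nonempty by (simp add: b_def)
  define V where "V n = S.span (b ` {..n})" for n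
  have cover: "p \<in> (\<Union>n. V n)" for p
  proof -
    have "p \<in> S.span B" using B(2) by simp
    then obtain t r where t: "finite t" "t \<subseteq> B" "p = (\<Sum>a\<in>t. scalar (r a) * a)"
      unfolding S.span_explicit by blast
    obtain N where N: "finite N" "t = b ` N"
      using finite_subset_image[of t b UNIV] t b by auto
    obtain n where "N \<subseteq> {..n}"
      using N(1) by (meson finite_nat_iff_bounded_le)
    then have "t \<subseteq> b ` {..n}"
      using N by auto
    then have "p \<in> V n"
      unfolding V_def t(3) by (intro S.span_sum S.span_scale S.span_base) auto
    then show ?thesis by blast
  qed
  have "finite (A \<inter> V n)" for n
    using S.independent_span_bound[of "b ` {..n}" "A \<inter> V n"] S.independent_mono[OF indep, of "A \<inter> V n"]
    by (simp add: V_def)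
  then have "countable (\<Union>n. A \<inter> V n)"
    by (intro countable_UN) (auto intro: countable_finite)
  moreover have "(\<Union>n. A \<inter> V n) = A"
    using cover by blast
  ultimately show ?thesis by simp
qed

text \<open>
If no \<open>v - a\<close> lies in \<open>M\<close>, each has an inverse \<open>g a\<close> modulo \<open>M\<close>.  These are uncountably many
different elements of a space of countable dimension, hence linearly dependent.  Clearing
denominators in a dependency gives a nonzero polynomial in the single element \<open>v\<close> that lies in \<open>M\<close>;
it splits into linear factors over \<open>\<complex>\<close>, and one of these lies in the prime ideal \<open>M\<close>.
\<close>

lemma maximal_ideal_contains_linear:
  assumes M: "maximal_ideal M"
  obtains a where "v - scalar a \<in> M"
proof (rule ccontr)
  assume "\<not> thesis"
  then have "v - scalar a \<notin> M" for a
    using that by blast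
  then have "\<exists>g. g * (v - scalar a) - 1 \<in> M" for a
    using maximal_ideal_inverse[OF M] by metis
  then obtain g where g: "g a * (v - scalar a) - 1 \<in> M" for a
    by metis
  have I: "is_ideal M" and one: "1 \<notin> M"
    using M by (auto simp: maximal_ideal_def)
  note I_rules = is_idealD[OF I]
  have nonscalar: "scalar a \<in> M \<longleftrightarrow> a = 0" for a
    by (rule scalar_in_ideal_iff[OF I one])
  have inj: "inj g"
  proof (rule injI)
    fix a b assume ab: "g a = g b"
    have "g a * scalar (a - b) = (g b * (v - scalar b) - 1) - (g a * (v - scalar a) - 1)"
      by (simp add: ab algebra_simps)
    then have "g a * scalar (a - b) \<in> M"
      using I_rules(6)[OF g g] by simp
    moreover have "g a \<notin> M"
    proof
      assume "g a \<in> M"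
      then have "g a * (v - scalar a) - (g a * (v - scalar a) - 1) \<in> M"
        by (intro I_rules(4,6) g)
      then show False using one by simp
    qed
    ultimately have "scalar (a - b) \<in> M"
      by (rule maximal_ideal_prime[OF M])
    then show "a = b"
      unfolding nonscalar by simp
  qed
  have "\<not> countable (range g)"
    using inj uncountable_UNIV_complex by (simp add: countable_image_inj_eq)
  then have "S.dependent (range g)"
    using S_independent_countable by blast
  then obtain t u w where t: "finite t" "t \<subseteq> range g" "w \<in> t" "u w \<noteq> 0"
    "(\<Sum>p\<in>t. scalar (u p) * p) = 0"
    unfolding S.dependent_explicit by blast
  obtain A where A: "finite A" "t = g ` A"
    using finite_subset_image[OF t(1,2)] by blast
  have sum0: "(\<Sum>a\<in>A. scalar (u (g a)) * g a) = 0"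
    using t(5) unfolding A(2) by (subst (asm) sum.reindex) (auto intro: inj_on_subset[OF inj])
  obtain a0 where a0: "a0 \<in> A" "u (g a0) \<noteq> 0"
    using t(3,4) A(2) by blast
  define P where "P B = (\<Prod>b\<in>B. v - scalar b)" for B
  have P_split: "P A = (v - scalar a) * P (A - {a})" if "a \<in> A" for a
    unfolding P_def by (rule prod.remove[OF A(1) that])
  have "(\<Sum>a\<in>A. scalar (u (g a)) * P (A - {a})) =
    P A * (\<Sum>a\<in>A. scalar (u (g a)) * g a)
      - (\<Sum>a\<in>A. scalar (u (g a)) * P (A - {a}) * (g a * (v - scalar a) - 1))"
    unfolding sum_distrib_left sum_subtractf[symmetric]
    by (intro sum.cong refl) (simp add: P_split algebra_simps)
  also have "\<dots> \<in> M"
    unfolding sum0 by (intro I_rules(6) is_ideal_sum[OF I]) (auto intro: I_rules g)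
  finally have sum: "(\<Sum>a\<in>A. scalar (u (g a)) * P (A - {a})) \<in> M" .
  \<comment> \<open>The dependency after multiplication by the product of all \<open>v - a\<close>, as a polynomial in one
      variable; its value at \<open>a0\<close> shows that it is nonzero.\<close>
  define q where "q = (\<Sum>a\<in>A. Polynomial.smult (u (g a)) (\<Prod>b\<in>A-{a}. [:- b, 1:]))"
  define ev where "ev = (\<lambda>p. poly (map_poly scalar p) v)"
  have ev: "ring_hom ev"
    unfolding ev_def by (rule ring_hom_poly_map_poly[OF ring_hom_scalar])
  have ev_prod: "ev (prod h B) = (\<Prod>b\<in>B. ev (h b))" for h :: "complex \<Rightarrow> complex poly" and B
    by (induction B rule: infinite_finite_induct) (simp_all add: ring_hom_simps[OF ev])
  have ev_lin: "ev [:- b, 1:] = v - scalar b" for b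
    by (simp add: ev_def map_poly_pCons)
  have ev_smult: "ev (Polynomial.smult s p) = scalar s * ev p" for s p
    by (simp add: ev_def map_poly_smult)
  have "ev q \<in> M"
    using sum unfolding q_def ring_hom_sum[OF ev] ev_smult ev_prod ev_lin P_def .
  have "poly q a0 = (\<Sum>a\<in>A. if a = a0 then u (g a0) * (\<Prod>b\<in>A-{a0}. a0 - b) else 0)"
    unfolding q_def poly_sum
  proof (intro sum.cong refl)
    fix a assume "a \<in> A"
    have "(\<Prod>b\<in>A-{a}. a0 - b) = 0" if "a \<noteq> a0"
      using that a0(1) A(1) by (intro prod_zero) auto
    then show "poly (Polynomial.smult (u (g a)) (\<Prod>b\<in>A-{a}. [:- b, 1:])) a0 =
      (if a = a0 then u (g a0) * (\<Prod>b\<in>A-{a0}. a0 - b) else 0)"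
      by (auto simp: poly_prod)
  qed
  also have "\<dots> = u (g a0) * (\<Prod>b\<in>A-{a0}. a0 - b)"
    using a0(1) A(1) by (simp add: sum.delta)
  also have "\<dots> \<noteq> 0"
    using a0(2) A(1) by auto
  finally have "q \<noteq> 0" by auto
  have "\<exists>a. v - scalar a \<in> M" if "q \<noteq> 0" "ev q \<in> M" for q
    using that
  proof (induction "degree q" arbitrary: q)
    case 0
    then obtain s where s: "q = [:s:]"
      by (metis degree_eq_zeroE)
    then have "ev q = scalar s"
      by (simp add: ev_def map_poly_pCons)
    then show ?case using 0 s nonscalar[of s] by simp
  next
    case (Suc n)
    obtain a where "poly q a = 0"
      using fundamental_theorem_of_algebra[of q] Suc(2) by (auto simp: constant_degree)
    then obtain r where r: "q = [:- a, 1:] * r"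
      by (auto simp: poly_eq_0_iff_dvd dvd_def)
    then have "r \<noteq> 0" using Suc(3) by auto
    then have "degree r = n"
      using Suc(2) r by (subst (asm) r, subst (asm) degree_mult_eq) auto
    have "(v - scalar a) * ev r \<in> M"
      using Suc(4) unfolding r ring_hom_simps(4)[OF ev] ev_lin .
    then show ?case
      using maximal_ideal_prime[OF M] Suc(1)[of r] \<open>degree r = n\<close> \<open>r \<noteq> 0\<close> by blast
  qed
  then show False
    using \<open>q \<noteq> 0\<close> \<open>ev q \<in> M\<close> \<open>\<And>a. v - scalar a \<notin> M\<close> by blast
qed

text \<open>
Modulo a maximal ideal above \<open>I\<close> the three variables are congruent to scalars, so every polynomial is
congruent to its value at the point with these coordinates.
\<close>

lemma weak_Nullstellensatz:
  assumes I: "is_ideal I" and one: "1 \<notin> I"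
  obtains P where "\<And>p. p \<in> I \<Longrightarrow> eval_at p P = 0"
proof -
  obtain M where M: "maximal_ideal M" "I \<subseteq> M"
    using exists_maximal_ideal[OF I one] .
  have MI: "is_ideal M" and oneM: "1 \<notin> M"
    using M(1) by (auto simp: maximal_ideal_def)
  note M_rules = is_idealD[OF MI]
  obtain a b c where abc: "xvar - scalar a \<in> M" "yvar - scalar b \<in> M" "zvar - scalar c \<in> M"
    using maximal_ideal_contains_linear[OF M(1)] by metis
  have cong: "p - scalar (eval_at p (a, b, c)) \<in> M" for p
  proof (induction p rule: S_induct)
    case (add p q)
    have "p + q - scalar (eval_at (p + q) (a, b, c)) =
      (p - scalar (eval_at p (a, b, c))) + (q - scalar (eval_at q (a, b, c)))"
      by simp
    also have "\<dots> \<in> M"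
      by (intro M_rules(2) add)
    finally show ?case .
  next
    case (mult p q)
    have "p * q - scalar (eval_at (p * q) (a, b, c)) =
      (p - scalar (eval_at p (a, b, c))) * q
        + scalar (eval_at p (a, b, c)) * (q - scalar (eval_at q (a, b, c)))"
      by (simp add: algebra_simps)
    also have "\<dots> \<in> M"
      by (intro M_rules(2) M_rules(4)[OF mult(1)] M_rules(3)[OF mult(2)])
    finally show ?case .
  qed (use abc M_rules(1) in simp_all)
  show ?thesis
  proof
    fix p assume "p \<in> I"
    define s where "s = eval_at p (a, b, c)"
    have "scalar s = p - (p - scalar s)"
      by simp
    also have "\<dots> \<in> M"
      using M_rules(6)[OF _ cong[of p], of p] \<open>p \<in> I\<close> M(2) unfolding s_def by blast
    finally show "eval_at p (a, b, c) = 0"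
      using scalar_in_ideal_iff[OF MI oneM] by (simp add: s_def)
  qed
qed

section \<open>Saturation of the ideal of two coprime forms\<close>

definition ideal2 :: "S \<Rightarrow> S \<Rightarrow> S set" where
  "ideal2 F G = {a * F + b * G | a b. True}"

lemma is_ideal_ideal2: "is_ideal (ideal2 F G)"
proof -
  have "0 \<in> ideal2 F G"
    unfolding ideal2_def by (intro CollectI exI[of _ 0]) simp
  moreover have "p + q \<in> ideal2 F G" if pq: "p \<in> ideal2 F G" "q \<in> ideal2 F G" for p q
  proof -
    obtain a b a' b' where "p = a * F + b * G" "q = a' * F + b' * G"
      using pq unfolding ideal2_def by blast
    then have "p + q = (a + a') * F + (b + b') * G"
      by (simp add: algebra_simps)
    then show ?thesis unfolding ideal2_def by blast
  qed
  moreover have "s * p \<in> ideal2 F G" if p: "p \<in> ideal2 F G" for p s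
  proof -
    obtain a b where "p = a * F + b * G"
      using p unfolding ideal2_def by blast
    then have "s * p = (s * a) * F + (s * b) * G"
      by (simp add: algebra_simps)
    then show ?thesis unfolding ideal2_def by blast
  qed
  ultimately show ?thesis
    unfolding is_ideal_def by blast
qed

lemmas ideal2_rules = is_idealD[OF is_ideal_ideal2]

lemma ideal2_generators: "F \<in> ideal2 F G" "G \<in> ideal2 F G"
proof -
  have "F = 1 * F + 0 * G" "G = 0 * F + 1 * G"
    by simp_all
  then show "F \<in> ideal2 F G" "G \<in> ideal2 F G"
    unfolding ideal2_def by blast+
qed

lemma dvd_in_ideal2: "F dvd p \<Longrightarrow> p \<in> ideal2 F G" "G dvd p \<Longrightarrow> p \<in> ideal2 F G"
  using ideal2_rules(4) ideal2_generators by (auto elim!: dvdE)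

lemma ideal2E:
  assumes "c \<in> ideal2 F G"
  obtains a b where "c = a * F + b * G"
  using assms unfolding ideal2_def by blast

text \<open>
The only relations between \<open>F\<close> and \<open>G\<close> are the multiples of the Koszul relation.
\<close>

lemma coprime_relation:
  fixes F G :: S
  assumes "prime_elem F" and "\<not> F dvd G" and rel: "a * F + b * G = 0"
  obtains k where "b = k * F" and "a = - (k * G)"
proof -
  have "F dvd b * G"
  proof
    show "b * G = F * (- a)"
      using rel by (simp add: eq_neg_iff_add_eq_0 algebra_simps)
  qed
  then have "F dvd b"
    using assms by (auto simp: prime_elem_dvd_mult_iff)
  then obtain k where "b = F * k"
    by (rule dvdE)
  then have k: "b = k * F"
    by (simp add: mult.commute)
  have "(a + k * G) * F = 0"
    using rel k by (simp add: algebra_simps)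
  moreover have "F \<noteq> 0"
    using assms(1) by auto
  ultimately show ?thesis
    by (intro that[of k]) (simp_all add: k eq_neg_iff_add_eq_0)
qed

lemma reduce_mod_xy:
  obtains \<epsilon> :: "S \<Rightarrow> S" where "ring_hom \<epsilon>" "\<epsilon> xvar = 0" "\<epsilon> yvar = 0" "\<epsilon> zvar = zvar"
    "\<And>p. p - \<epsilon> p \<in> ideal2 xvar yvar"
proof
  define \<epsilon> where "\<epsilon> = subst scalar 0 0 zvar"
  have \<epsilon>: "ring_hom \<epsilon>" "\<epsilon> xvar = 0" "\<epsilon> yvar = 0" "\<epsilon> zvar = zvar" "\<And>a. \<epsilon> (scalar a) = scalar a"
    unfolding \<epsilon>_def by (simp_all add: ring_hom_subst ring_hom_scalar)
  then show "ring_hom \<epsilon>" "\<epsilon> xvar = 0" "\<epsilon> yvar = 0" "\<epsilon> zvar = zvar"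
    by simp_all
  show "p - \<epsilon> p \<in> ideal2 xvar yvar" for p
  proof (induction p rule: S_induct)
    case (add p q)
    have "p + q - \<epsilon> (p + q) = (p - \<epsilon> p) + (q - \<epsilon> q)"
      by (simp add: ring_hom_simps[OF \<epsilon>(1)])
    also have "\<dots> \<in> ideal2 xvar yvar"
      by (intro ideal2_rules(2) add)
    finally show ?case .
  next
    case (mult p q)
    have "p * q - \<epsilon> (p * q) = (p - \<epsilon> p) * q + \<epsilon> p * (q - \<epsilon> q)"
      by (simp add: ring_hom_simps[OF \<epsilon>(1)] algebra_simps)
    also have "\<dots> \<in> ideal2 xvar yvar"
      by (intro ideal2_rules(2) ideal2_rules(4)[OF mult(1)] ideal2_rules(3)[OF mult(2)])
    finally show ?case .
  qed (simp_all add: \<epsilon> ideal2_rules(1) ideal2_generators)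
qed

lemma xvar_nonzero: "xvar \<noteq> 0"
  by (simp add: xvar_def)

lemma xvar_dvd_if_dvd_yvar_mult:
  assumes "xvar dvd yvar * p"
  shows "xvar dvd p"
proof -
  define \<epsilon> where "\<epsilon> = subst scalar 0 yvar zvar"
  have \<epsilon>: "ring_hom \<epsilon>" "\<epsilon> xvar = 0" "\<epsilon> yvar = yvar" "\<epsilon> zvar = zvar" "\<And>a. \<epsilon> (scalar a) = scalar a"
    unfolding \<epsilon>_def by (simp_all add: ring_hom_subst ring_hom_scalar)
  have cong: "xvar dvd q - \<epsilon> q" for q
  proof (induction q rule: S_induct)
    case (add p q)
    then show ?case
      using dvd_add[OF add] by (simp add: ring_hom_simps[OF \<epsilon>(1)] algebra_simps)
  next
    case (mult p q)
    have "p * q - \<epsilon> (p * q) = (p - \<epsilon> p) * q + \<epsilon> p * (q - \<epsilon> q)"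
      by (simp add: ring_hom_simps[OF \<epsilon>(1)] algebra_simps)
    then show ?case using mult by simp
  qed (simp_all add: \<epsilon>)
  obtain q where "yvar * p = xvar * q"
    using assms by (elim dvdE)
  then have "yvar * \<epsilon> p = 0"
    using \<epsilon>(2,3) ring_hom_simps(4)[OF \<epsilon>(1)] by (metis mult_zero_left)
  then have "\<epsilon> p = 0"
    by (simp add: yvar_def)
  then show ?thesis
    using cong[of p] by simp
qed

lemma zvar_nonzerodivisor_mod_xy:
  assumes "zvar * p \<in> ideal2 xvar yvar"
  shows "p \<in> ideal2 xvar yvar"
proof -
  obtain \<epsilon> :: "S \<Rightarrow> S" where \<epsilon>: "ring_hom \<epsilon>" "\<epsilon> xvar = 0" "\<epsilon> yvar = 0" "\<epsilon> zvar = zvar"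
    and cong: "\<And>p. p - \<epsilon> p \<in> ideal2 xvar yvar"
    using reduce_mod_xy by blast
  obtain a b where "zvar * p = a * xvar + b * yvar"
    using assms by (rule ideal2E)
  then have "\<epsilon> (zvar * p) = \<epsilon> (a * xvar + b * yvar)"
    by (rule arg_cong)
  then have "zvar * \<epsilon> p = 0"
    by (simp add: ring_hom_simps[OF \<epsilon>(1)] \<epsilon>)
  then have "\<epsilon> p = 0"
    by (simp add: zvar_def)
  then show ?thesis
    using cong[of p] by simp
qed

text \<open>
The maximal ideal \<open>(x, y, z)\<close> is not associated to \<open>(F, G)\<close>: in three variables, a quotient by two
coprime polynomials still has positive depth.  Concretely, write \<open>x c\<close>, \<open>y c\<close>, \<open>z c\<close> in terms of \<open>F\<close>
and \<open>G\<close>.  Comparing two of these expressions gives relations between \<open>F\<close> and \<open>G\<close>, hence Koszul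
multipliers \<open>k12\<close>, \<open>k13\<close>, \<open>k23\<close>, and these satisfy \<open>z k12 - y k13 + x k23 = 0\<close>.  Regularity of \<open>x, y, z\<close>
puts \<open>k12\<close> into \<open>(x, y)\<close>, and correcting the first expression accordingly makes it divisible by \<open>x\<close>.
\<close>

lemma coprime_ideal_depth:
  assumes F: "prime_elem F" and FG: "\<not> F dvd G"
    and x: "xvar * c \<in> ideal2 F G" and y: "yvar * c \<in> ideal2 F G" and z: "zvar * c \<in> ideal2 F G"
  shows "c \<in> ideal2 F G"
proof -
  obtain a1 b1 where 1: "xvar * c = a1 * F + b1 * G" using x by (rule ideal2E)
  obtain a2 b2 where 2: "yvar * c = a2 * F + b2 * G" using y by (rule ideal2E)
  obtain a3 b3 where 3: "zvar * c = a3 * F + b3 * G" using z by (rule ideal2E)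
  have F0: "F \<noteq> 0"
    using F by auto
  have rel: "(v * a - w * a') * F + (v * b - w * b') * G = 0"
    if "w * c = a * F + b * G" "v * c = a' * F + b' * G" for v w a b a' b'
  proof -
    have "(v * a - w * a') * F + (v * b - w * b') * G = v * (a * F + b * G) - w * (a' * F + b' * G)"
      by (simp add: algebra_simps)
    also have "\<dots> = 0"
      unfolding that[symmetric] by simp
    finally show ?thesis .
  qed
  obtain k12 where k12: "yvar * b1 - xvar * b2 = k12 * F" "yvar * a1 - xvar * a2 = - (k12 * G)"
    using coprime_relation[OF F FG rel[OF 1 2]] .
  obtain k13 where k13: "zvar * b1 - xvar * b3 = k13 * F"
    using coprime_relation[OF F FG rel[OF 1 3]] .
  obtain k23 where k23: "zvar * b2 - yvar * b3 = k23 * F"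
    using coprime_relation[OF F FG rel[OF 2 3]] .
  have "(zvar * k12) * F = (k13 * yvar + (- k23) * xvar) * F"
  proof -
    have "(zvar * k12 - (k13 * yvar + (- k23) * xvar)) * F
      = zvar * (k12 * F) - yvar * (k13 * F) + xvar * (k23 * F)"
      by (simp add: algebra_simps)
    also have "\<dots> = 0"
      unfolding k12(1)[symmetric] k13[symmetric] k23[symmetric] by (simp add: algebra_simps)
    finally show ?thesis
      by (simp add: left_diff_distrib)
  qed
  then have "zvar * k12 = (- k23) * xvar + k13 * yvar"
    unfolding mult_right_cancel[OF F0] by simp
  then have "zvar * k12 \<in> ideal2 xvar yvar"
    unfolding ideal2_def by blast
  then have "k12 \<in> ideal2 xvar yvar"
    by (rule zvar_nonzerodivisor_mod_xy)
  then obtain s2 s1 where s: "k12 = s2 * xvar + s1 * yvar"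
    by (rule ideal2E)
  have "xvar dvd yvar * (b1 - s1 * F)"
  proof
    show "yvar * (b1 - s1 * F) = xvar * (b2 + s2 * F)"
      using k12(1) unfolding s by (simp add: algebra_simps)
  qed
  then obtain b' where b': "b1 - s1 * F = xvar * b'"
    using xvar_dvd_if_dvd_yvar_mult by blast
  have "xvar dvd yvar * (a1 + s1 * G)"
  proof
    show "yvar * (a1 + s1 * G) = xvar * (a2 - s2 * G)"
      using k12(2) unfolding s by (simp add: algebra_simps)
  qed
  then obtain a' where a': "a1 + s1 * G = xvar * a'"
    using xvar_dvd_if_dvd_yvar_mult by blast
  have "xvar * c = (a1 + s1 * G) * F + (b1 - s1 * F) * G"
    unfolding 1 by (simp add: algebra_simps)
  also have "\<dots> = xvar * (a' * F + b' * G)"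
    unfolding a' b' by (simp add: algebra_simps)
  finally have "c = a' * F + b' * G"
    by (simp add: xvar_nonzero)
  then show ?thesis
    unfolding ideal2_def by blast
qed

text \<open>
The last multiple \<open>v\<^sup>n c\<close> outside \<open>J\<close>.
\<close>

lemma socle_power:
  fixes c v :: S
  assumes "c \<notin> J" and "v ^ N * c \<in> J"
  obtains n :: nat where "v ^ n * c \<notin> J" and "v * (v ^ n * c) \<in> J"
proof -
  have "\<exists>n. v ^ n * c \<notin> J \<and> v ^ Suc n * c \<in> J"
  proof (rule ccontr)
    assume "\<not> ?thesis"
    then have "v ^ n * c \<notin> J" for n
      by (induction n) (use assms(1) in auto)
    then show False using assms(2) by blast
  qed
  then show ?thesis
    using that by (auto simp: mult.assoc)
qed

lemma coprime_ideal_depth_power: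
  assumes F: "prime_elem F" and FG: "\<not> F dvd G"
    and x: "xvar ^ N1 * c \<in> ideal2 F G" and y: "yvar ^ N2 * c \<in> ideal2 F G"
    and z: "zvar ^ N3 * c \<in> ideal2 F G"
  shows "c \<in> ideal2 F G"
proof (rule ccontr)
  assume c: "c \<notin> ideal2 F G"
  obtain i where i: "xvar ^ i * c \<notin> ideal2 F G" "xvar * (xvar ^ i * c) \<in> ideal2 F G"
    using socle_power[OF c x] .
  have "yvar ^ N2 * (xvar ^ i * c) \<in> ideal2 F G"
    using ideal2_rules(3)[OF y, of "xvar ^ i"] by (simp add: ac_simps)
  then obtain j where j: "yvar ^ j * (xvar ^ i * c) \<notin> ideal2 F G"
      "yvar * (yvar ^ j * (xvar ^ i * c)) \<in> ideal2 F G"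
    using socle_power[OF i(1)] by blast
  have "zvar ^ N3 * (yvar ^ j * (xvar ^ i * c)) \<in> ideal2 F G"
    using ideal2_rules(3)[OF z, of "yvar ^ j * xvar ^ i"] by (simp add: ac_simps)
  then obtain k where k: "zvar ^ k * (yvar ^ j * (xvar ^ i * c)) \<notin> ideal2 F G"
      "zvar * (zvar ^ k * (yvar ^ j * (xvar ^ i * c))) \<in> ideal2 F G"
    using socle_power[OF j(1)] by blast
  have "xvar * (zvar ^ k * (yvar ^ j * (xvar ^ i * c))) \<in> ideal2 F G"
    using ideal2_rules(3)[OF i(2), of "zvar ^ k * yvar ^ j"] by (simp add: ac_simps)
  moreover have "yvar * (zvar ^ k * (yvar ^ j * (xvar ^ i * c))) \<in> ideal2 F G"
    using ideal2_rules(3)[OF j(2), of "zvar ^ k"] by (simp add: ac_simps)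
  ultimately show False
    using coprime_ideal_depth[OF F FG] k by blast
qed

lemma component_ideal2:
  assumes "homogeneous i F" and "homogeneous j G" and "c \<in> ideal2 F G"
  shows "component n c \<in> ideal2 F G"
proof -
  obtain a b where c: "c = a * F + b * G"
    using assms(3) by (rule ideal2E)
  have "component n (a * F) \<in> ideal2 F G" "component n (b * G) \<in> ideal2 F G"
    using assms(1,2) ideal2_rules(1,4) ideal2_generators
    by (simp_all add: homogeneous_iff_grade mult.commute[of _ "monom _ _"] coeff_monom_mult)
  then show ?thesis
    unfolding c by (simp add: ideal2_rules(2))
qed

text \<open>
Setting \<open>v = 1\<close> kills only the \<open>v\<close>-power torsion of the graded module \<open>S/(F, G)\<close>.  If
\<open>c = q + h (v - 1)\<close>, then modulo \<open>(F, G)\<close> the components of \<open>h\<close> vanish below the degree \<open>n\<close> of \<open>c\<close> and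
equal \<open>- v\<^sup>k c\<close> in degree \<open>n + k\<close>; the latter are zero for large \<open>k\<close>.
\<close>

lemma dehomogenize:
  assumes F: "homogeneous i F" and G: "homogeneous j G" and c: "homogeneous n c"
    and v: "homogeneous 1 v" and mem: "c \<in> adjoin (ideal2 F G) (v - 1)"
  obtains N where "v ^ N * c \<in> ideal2 F G"
proof -
  obtain q h where qh: "c = q + h * (v - 1)" "q \<in> ideal2 F G"
    using mem unfolding adjoin_def by blast
  define H where "H = grade h"
  have q: "component k q \<in> ideal2 F G" for k
    by (rule component_ideal2[OF F G qh(2)])
  have "q = c - h * (v - 1)"
    using qh(1) by simp
  then have "grade q = grade c - H * (monom v 1 - 1)"
    using v unfolding H_def by (simp add: homogeneous_iff_grade)
  also have "\<dots> = monom c n - monom v 1 * H + H"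
    using c by (simp add: homogeneous_iff_grade algebra_simps)
  finally have grade_q: "grade q = monom c n - monom v 1 * H + H" .
  have comp0: "component 0 q = (if n = 0 then c else 0) + coeff H 0"
    unfolding grade_q by (simp add: coeff_monom_mult)
  have compS: "component (Suc k) q = (if n = Suc k then c else 0) - v * coeff H k + coeff H (Suc k)" for k
    unfolding grade_q by (simp add: coeff_monom_mult)
  have low: "k < n \<Longrightarrow> coeff H k \<in> ideal2 F G" for k
  proof (induction k)
    case 0
    then show ?case using q[of 0] comp0 by simp
  next
    case (Suc k)
    have "coeff H (Suc k) = component (Suc k) q + v * coeff H k"
      using Suc(2) compS[of k] by simp
    then show ?case
      using Suc ideal2_rules(2)[OF q[of "Suc k"] ideal2_rules(3)] by simp
  qed
  have high: "v ^ k * c + coeff H (n + k) \<in> ideal2 F G" for k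
  proof (induction k)
    case 0
    show ?case
    proof (cases n)
      case 0
      then show ?thesis using q[of 0] comp0 by simp
    next
      case (Suc n')
      then have "c + coeff H n = component n q + v * coeff H n'"
        using compS[of n'] by simp
      then show ?thesis
        using ideal2_rules(2)[OF q[of n] ideal2_rules(3)[OF low[of n']]] Suc by simp
    qed
  next
    case (Suc k)
    have "v ^ Suc k * c + coeff H (n + Suc k)
      = v * (v ^ k * c + coeff H (n + k)) + component (n + Suc k) q"
      using compS[of "n + k"] by (simp add: algebra_simps)
    then show ?case
      using ideal2_rules(2)[OF ideal2_rules(3)[OF Suc] q] by simp
  qed
  have "coeff H (n + Suc (degree H)) = 0"
    by (rule coeff_eq_0) simp
  then have "v ^ Suc (degree H) * c \<in> ideal2 F G"
    using high[of "Suc (degree H)"] by simp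
  then show ?thesis by (rule that)
qed

text \<open>
All memberships in the proof of generation come from this lemma.  One may take \<open>c\<close> homogeneous.  If
powers of all three variables multiply \<open>c\<close> into \<open>(F, G)\<close>, then \<open>c\<close> lies there by
\<open>coprime_ideal_depth_power\<close>.  Otherwise no power of some variable \<open>v\<close> does, so \<open>c\<close> is not in the ideal
\<open>J = (F, G, v - 1)\<close>.  The ideal of all \<open>h\<close> with \<open>h c \<in> J\<close> is then proper, and the Nullstellensatz yields
a common zero of \<open>F\<close>, \<open>G\<close>, \<open>H\<close> and \<open>v - 1\<close>, which is not the origin.
\<close>

lemma saturation:
  assumes F: "prime_elem F" and FG: "\<not> F dvd G"
    and hom: "homogeneous i F" "homogeneous j G" "\<And>h. h \<in> H \<Longrightarrow> \<exists>k. homogeneous k h"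
    and colon: "\<And>h. h \<in> H \<Longrightarrow> h * c \<in> ideal2 F G"
    and no_zero: "\<And>P. P \<noteq> (0, 0, 0) \<Longrightarrow> eval_at F P = 0 \<Longrightarrow> eval_at G P = 0 \<Longrightarrow>
                    \<exists>h\<in>H. eval_at h P \<noteq> 0"
  shows "c \<in> ideal2 F G"
proof -
  have "component n c \<in> ideal2 F G" for n
  proof (rule ccontr)
    define c' where "c' = component n c"
    assume "component n c \<notin> ideal2 F G"
    then have c': "c' \<notin> ideal2 F G" "homogeneous n c'"
      by (simp_all add: c'_def homogeneous_component)
    have colon': "h * c' \<in> ideal2 F G" if h: "h \<in> H" for h
    proof -
      obtain k where k: "homogeneous k h"
        using hom(3)[OF h] by blast
      show ?thesis
        using component_ideal2[OF hom(1,2) colon[OF h], of "k + n"]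
        unfolding component_homogeneous_mult[OF k] c'_def .
    qed
    have "\<exists>v\<in>{xvar, yvar, zvar}. \<forall>N. v ^ N * c' \<notin> ideal2 F G"
    proof (rule ccontr)
      assume "\<not> ?thesis"
      then obtain N1 N2 N3 where "xvar ^ N1 * c' \<in> ideal2 F G" "yvar ^ N2 * c' \<in> ideal2 F G"
          "zvar ^ N3 * c' \<in> ideal2 F G"
        by blast
      then show False
        using coprime_ideal_depth_power[OF F FG] c'(1) by metis
    qed
    then obtain v where v: "v \<in> {xvar, yvar, zvar}" "\<And>N. v ^ N * c' \<notin> ideal2 F G"
      by blast
    have v_hom: "homogeneous 1 v"
      using v(1) homogeneous_xyz by blast
    define J where "J = adjoin (ideal2 F G) (v - 1)"
    have J: "is_ideal J" "ideal2 F G \<subseteq> J" "v - 1 \<in> J"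
      unfolding J_def by (intro adjoin is_ideal_ideal2)+
    define Q where "Q = {h. h * c' \<in> J}"
    have "is_ideal Q"
      using is_idealD[OF J(1)] unfolding is_ideal_def Q_def by (auto simp: distrib_right mult.assoc)
    moreover have "1 \<notin> Q"
      using dehomogenize[OF hom(1,2) c'(2) v_hom] v(2) unfolding Q_def J_def by force
    ultimately obtain P where P: "\<And>p. p \<in> Q \<Longrightarrow> eval_at p P = 0"
      using weak_Nullstellensatz by blast
    have "v - 1 \<in> Q" "F \<in> Q" "G \<in> Q"
      using J ideal2_generators is_idealD(4)[OF J(1)] unfolding Q_def by blast+
    moreover have "h \<in> Q" if "h \<in> H" for h
      using colon'[OF that] J(2) unfolding Q_def by blast
    ultimately have PP: "eval_at v P = 1" "eval_at F P = 0" "eval_at G P = 0"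
        "\<And>h. h \<in> H \<Longrightarrow> eval_at h P = 0"
      using P[of "v - 1"] P by auto
    have "P \<noteq> (0, 0, 0)"
      using PP(1) v(1) by auto
    then show False
      using no_zero PP by blast
  qed
  then have "(\<Sum>n\<le>degree (grade c). component n c) \<in> ideal2 F G"
    by (intro is_ideal_sum is_ideal_ideal2)
  then show ?thesis
    unfolding sum_components .
qed

section \<open>Vector algebra over the polynomial ring\<close>

fun dot :: "S3 \<Rightarrow> S3 \<Rightarrow> S" where
  "dot (a, b, c) (a', b', c') = a * a' + b * b' + c * c'"

fun cross :: "S3 \<Rightarrow> S3 \<Rightarrow> S3" where
  "cross (a, b, c) (a', b', c') = (b * c' - c * b', c * a' - a * c', a * b' - b * a')"

definition position :: S3 where "position = (xvar, yvar, zvar)"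

lemma syzygy_of_wedge: "syzygy_of_form (wedge u v) = cross u v"
  by (cases u; cases v) simp

lemma D0_iff_dot: "s \<in> D0 f \<longleftrightarrow> dot s (ext_d f) = 0"
  by (cases s) (simp add: D0_def ext_d_def)

lemma scale3_simps:
  "scale3 p (u + v) = scale3 p u + scale3 p v" "scale3 (p + q) u = scale3 p u + scale3 q u"
  "scale3 p (u - v) = scale3 p u - scale3 p v" "scale3 (p - q) u = scale3 p u - scale3 q u"
  "scale3 p (scale3 q u) = scale3 (p * q) u" "scale3 p 0 = 0" "scale3 0 u = 0" "scale3 1 u = u"
  by (cases u; cases v; simp add: algebra_simps zero_prod_def)+

lemma dot_simps:
  "dot (u + v) w = dot u w + dot v w" "dot w (u + v) = dot w u + dot w v"
  "dot (scale3 p u) w = p * dot u w" "dot w (scale3 p u) = p * dot w u"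
  "dot 0 w = 0" "dot w 0 = 0"
  by (cases u; cases v; cases w; simp add: algebra_simps zero_prod_def)+

lemma cross_simps:
  "cross (u + v) w = cross u w + cross v w" "cross w (u + v) = cross w u + cross w v"
  "cross (u - v) w = cross u w - cross v w" "cross w (u - v) = cross w u - cross w v"
  "cross (scale3 p u) w = scale3 p (cross u w)" "cross w (scale3 p u) = scale3 p (cross w u)"
  "cross 0 w = 0" "cross w 0 = 0" "cross w w = 0"
  by (cases u; cases v; cases w; simp add: algebra_simps zero_prod_def)+

lemma dot_commute: "dot u v = dot v u"
  by (cases u; cases v) (simp add: mult.commute)

lemma dot_cross_self: "dot (cross u v) u = 0"
  by (cases u; cases v) (simp add: algebra_simps)

lemma cross_cross: "cross u (cross v w) = scale3 (dot u w) v - scale3 (dot u v) w"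
  by (cases u; cases v; cases w) (simp add: algebra_simps)

lemma scale3_sum: "scale3 p (sum g A) = (\<Sum>i\<in>A. scale3 p (g i))"
  by (induction A rule: infinite_finite_induct) (simp_all add: scale3_simps)

lemma dot_sum: "dot w (sum g A) = (\<Sum>i\<in>A. dot w (g i))"
  by (induction A rule: infinite_finite_induct) (simp_all add: dot_simps)

lemma cross_sum: "cross w (sum g A) = (\<Sum>i\<in>A. cross w (g i))"
  by (induction A rule: infinite_finite_induct) (simp_all add: cross_simps)

lemma cross_sum_left: "cross (sum g A) w = (\<Sum>i\<in>A. cross (g i) w)"
  by (induction A rule: infinite_finite_induct) (simp_all add: cross_simps)

lemma scale3_cancel: "p \<noteq> 0 \<Longrightarrow> scale3 p u = scale3 p v \<longleftrightarrow> u = v"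
  by (cases u; cases v) simp

lemma syzygy_of_form_scale3: "syzygy_of_form (scale3 p u) = scale3 p (syzygy_of_form u)"
  by (cases u) simp

lemma syzygy_of_form_sum: "syzygy_of_form (sum g A) = (\<Sum>i\<in>A. syzygy_of_form (g i))"
proof -
  have "syzygy_of_form (u + v) = syzygy_of_form u + syzygy_of_form v" for u v
    by (cases u; cases v) simp
  then show ?thesis
    by (induction A rule: infinite_finite_induct) (simp_all add: zero_prod_def)
qed

text \<open>
Congruence of vectors to \<open>0\<close> modulo \<open>p\<close>, that is, divisibility of all three components.
\<close>

definition dvd3 :: "S \<Rightarrow> S3 \<Rightarrow> bool" where
  "dvd3 p v \<longleftrightarrow> (\<exists>w. v = scale3 p w)"

lemma dvd3_iff: "dvd3 p (a, b, c) \<longleftrightarrow> p dvd a \<and> p dvd b \<and> p dvd c"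
  by (auto simp: dvd3_def dvd_def)

lemma dvd3_add: "dvd3 p u \<Longrightarrow> dvd3 p v \<Longrightarrow> dvd3 p (u + v)"
  and dvd3_diff: "dvd3 p u \<Longrightarrow> dvd3 p v \<Longrightarrow> dvd3 p (u - v)"
  and dvd3_scale: "p dvd s \<Longrightarrow> dvd3 p (scale3 s u)"
  by (cases u; cases v; simp add: dvd3_iff)+

lemma dvd3_0: "dvd3 p 0"
  by (simp add: dvd3_iff zero_prod_def)

lemma dvd3_sum: "(\<And>i. i \<in> A \<Longrightarrow> dvd3 p (g i)) \<Longrightarrow> dvd3 p (sum g A)"
  by (induction A rule: infinite_finite_induct) (auto simp: dvd3_0 intro: dvd3_add)

lemma ext_d_mult: "ext_d (p * q) = scale3 p (ext_d q) + scale3 q (ext_d p)"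
  by (simp add: ext_d_def)

lemma partial_1 [simp]: "partial_x 1 = 0" "partial_y 1 = 0" "partial_z 1 = 0"
  using partial_mult[of 1 1] by simp_all

lemma ext_d_prod:
  assumes "finite A"
  shows "ext_d (prod g A) = (\<Sum>j\<in>A. scale3 (prod g (A - {j})) (ext_d (g j)))"
  using assms
proof (induction A rule: finite_induct)
  case empty
  then show ?case by (simp add: ext_d_def zero_prod_def)
next
  case (insert i A)
  have "prod g (insert i A - {j}) = g i * prod g (A - {j})" if "j \<in> A" for j
  proof -
    have "insert i A - {j} = insert i (A - {j})"
      using insert(2) that by auto
    then show ?thesis using insert(1,2) by simp
  qed
  then have "(\<Sum>j\<in>A. scale3 (prod g (insert i A - {j})) (ext_d (g j)))
    = scale3 (g i) (ext_d (prod g A))"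
    unfolding insert(3) scale3_sum by (intro sum.cong) (simp_all add: scale3_simps)
  moreover have "insert i A - {i} = A"
    using insert(2) by auto
  ultimately show ?case
    using insert(1,2) by (simp add: ext_d_mult add.commute)
qed

lemma euler_dot:
  assumes "homogeneous n p"
  shows "dot position (ext_d p) = of_nat n * p"
  using euler[OF assms] by (simp add: position_def ext_d_def)

section \<open>One-forms along a smooth curve\<close>

lemma homogeneous_dvd_lower_degree:
  assumes "homogeneous n p" and "homogeneous k q" and "k < n" and "p dvd q"
  shows "q = 0"
proof -
  obtain r where "q = p * r"
    using assms(4) by (rule dvdE)
  then have "monom q k = monom p n * grade r"
    using assms(1,2) by (simp add: homogeneous_iff_grade)
  then have "coeff (monom q k) k = coeff (monom p n * grade r) k"
    by simp
  then show ?thesis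
    using assms(3) by (simp add: coeff_monom_mult)
qed

text \<open>
The partial derivatives have smaller degree than \<open>f\<close>, so divisibility by \<open>f\<close> would make them vanish,
and \<open>f\<close> with them by Euler's formula.
\<close>

lemma exists_partial_not_divisible:
  assumes "prime_elem f" and hom: "homogeneous n f" and "n > 0"
  shows "\<not> dvd3 f (ext_d f)"
proof
  assume "dvd3 f (ext_d f)"
  then have "partial_x f = 0" "partial_y f = 0" "partial_z f = 0"
    using homogeneous_dvd_lower_degree[OF hom, of "n - 1"] homogeneous_partial[OF hom] \<open>n > 0\<close>
    by (auto simp: ext_d_def dvd3_iff)
  then have "of_nat n * f = 0"
    using euler[OF hom] by simp
  then show False
    using assms by auto
qed

text \<open>
Modulo \<open>f\<close>, a vector \<open>b\<close> parallel to \<open>p\<close> is a rational multiple of \<open>p\<close>.  The vanishing minors show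
\<open>p2 b1, p3 b1 \<in> (f, p1)\<close>.  As \<open>f\<close>, \<open>p1\<close>, \<open>p2\<close>, \<open>p3\<close> have no common zero in the plane, \<open>saturation\<close> gives
\<open>b1 = c p1\<close> modulo \<open>f\<close>, and this \<open>c\<close> works for the other components.
\<close>

lemma proportional_mod_prime:
  assumes f: "prime_elem f" and p1: "\<not> f dvd p1"
    and hom: "homogeneous n f" "homogeneous k p1" "homogeneous k p2" "homogeneous k p3"
    and no_zero: "\<And>P. P \<noteq> (0, 0, 0) \<Longrightarrow> eval_at f P = 0 \<Longrightarrow> eval_at p1 P = 0 \<Longrightarrow>
                    eval_at p2 P \<noteq> 0 \<or> eval_at p3 P \<noteq> 0"
    and minors: "f dvd p1 * b2 - p2 * b1" "f dvd p1 * b3 - p3 * b1"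
  obtains c where "f dvd b1 - c * p1" and "f dvd b2 - c * p2" and "f dvd b3 - c * p3"
proof -
  have "b1 \<in> ideal2 f p1"
  proof (rule saturation[OF f p1 hom(1,2), where H = "{p2, p3}"])
    show "\<exists>k. homogeneous k h" if "h \<in> {p2, p3}" for h
      using that hom by blast
    show "h * b1 \<in> ideal2 f p1" if h: "h \<in> {p2, p3}" for h
    proof -
      obtain b' where b': "f dvd p1 * b' - h * b1"
        using h minors by blast
      have "h * b1 = b' * p1 - (p1 * b' - h * b1)"
        by (simp add: algebra_simps)
      also have "\<dots> \<in> ideal2 f p1"
        by (intro ideal2_rules(6) dvd_in_ideal2(1)[OF b']) (simp add: dvd_in_ideal2(2))
      finally show ?thesis .
    qed
    show "\<exists>h\<in>{p2, p3}. eval_at h P \<noteq> 0"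
      if "P \<noteq> (0, 0, 0)" "eval_at f P = 0" "eval_at p1 P = 0" for P
      using no_zero[OF that] by blast
  qed
  then obtain a c where b1: "b1 = a * f + c * p1"
    by (rule ideal2E)
  have other: "f dvd b - c * p" if "f dvd p1 * b - p * b1" for b p
  proof -
    have "p1 * (b - c * p) = (p1 * b - p * b1) + f * (a * p)"
      by (simp add: b1 algebra_simps)
    then have "f dvd p1 * (b - c * p)"
      using that by simp
    then show ?thesis
      using f p1 by (simp add: prime_elem_dvd_mult_iff)
  qed
  show ?thesis
    by (rule that[of c]) (use other minors in \<open>simp_all add: b1\<close>)
qed

text \<open>
A one-form whose restriction to a smooth curve \<open>f = 0\<close> is pointwise proportional to \<open>df\<close> is a
polynomial multiple of \<open>df\<close> along the curve.  At least one partial derivative is prime to \<open>f\<close>; it takes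
the role of \<open>p1\<close> in \<open>proportional_mod_prime\<close>.
\<close>

lemma form_proportional_along_smooth_curve:
  assumes f: "prime_elem f" and hom: "homogeneous n f" and n: "n > 0" and smooth: "smooth_curve f"
    and \<beta>: "dvd3 f (cross (ext_d f) \<beta>)"
  obtains c where "dvd3 f (\<beta> - scale3 c (ext_d f))"
proof -
  define p1 p2 p3 where p: "p1 = partial_x f" "p2 = partial_y f" "p3 = partial_z f"
  note hom_p = homogeneous_partial[OF hom, folded p]
  obtain b1 b2 b3 where b: "\<beta> = (b1, b2, b3)"
    by (cases \<beta>)
  have grad: "ext_d f = (p1, p2, p3)"
    by (simp add: ext_d_def p)
  have minors: "f dvd p2 * b3 - p3 * b2" "f dvd p3 * b1 - p1 * b3" "f dvd p1 * b2 - p2 * b1"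
    using \<beta> by (simp_all add: grad b dvd3_iff)
  have flip: "f dvd b - a" if "f dvd a - b" for a b
    using that dvd_minus_iff[of f "a - b"] by simp
  note minors' = minors[THEN flip]
  have no_zero: "eval_at p1 P \<noteq> 0 \<or> eval_at p2 P \<noteq> 0 \<or> eval_at p3 P \<noteq> 0"
    if "P \<noteq> (0, 0, 0)" "eval_at f P = 0" for P
    using smooth that unfolding smooth_curve_def p by blast
  have "\<exists>c. f dvd b1 - c * p1 \<and> f dvd b2 - c * p2 \<and> f dvd b3 - c * p3"
  proof -
    consider "\<not> f dvd p1" | "\<not> f dvd p2" | "\<not> f dvd p3"
      using exists_partial_not_divisible[OF f hom n] by (auto simp: grad dvd3_iff)
    then show ?thesis
    proof cases
      case 1
      show ?thesis
        by (rule proportional_mod_prime[OF f 1 hom hom_p(1,2,3) _ minors(3) minors'(2)])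
          (use no_zero in blast)+
    next
      case 2
      show ?thesis
        by (rule proportional_mod_prime[OF f 2 hom hom_p(2,1,3) _ minors'(3) minors(1)])
          (use no_zero in blast)+
    next
      case 3
      show ?thesis
        by (rule proportional_mod_prime[OF f 3 hom hom_p(3,1,2) _ minors(2) minors'(1)])
          (use no_zero in blast)+
    qed
  qed
  then obtain c where "f dvd b1 - c * p1 \<and> f dvd b2 - c * p2 \<and> f dvd b3 - c * p3"
    by blast
  then show ?thesis
    by (intro that[of c]) (simp add: b grad dvd3_iff)
qed

section \<open>Generators of the syzygy module\<close>

locale normal_crossing_curve =
  fixes m :: nat and F :: "nat \<Rightarrow> S" and e :: "nat \<Rightarrow> nat"
  assumes m_pos: "m \<ge> 1"
    and homogeneous_F: "\<And>j. j \<in> {1..m} \<Longrightarrow> homogeneous (e j) (F j)"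
    and irreducible_F: "\<And>j. j \<in> {1..m} \<Longrightarrow> irreducible (F j)"
    and not_dvd_F: "\<And>i j. i \<in> {1..m} \<Longrightarrow> j \<in> {1..m} \<Longrightarrow> i \<noteq> j \<Longrightarrow> \<not> F i dvd F j"
    and smooth_F: "\<And>j. j \<in> {1..m} \<Longrightarrow> smooth_curve (F j)"
    and normal_crossing_F: "normal_crossing m F"
begin

definition f :: S where "f = (\<Prod>j\<in>{1..m}. F j)"

definition d :: nat where "d = (\<Sum>j\<in>{1..m}. e j)"

definition cofactor :: "nat \<Rightarrow> S" where "cofactor j = (\<Prod>i\<in>{1..m}-{j}. F i)"

abbreviation grad :: "nat \<Rightarrow> S3" where "grad j \<equiv> ext_d (F j)"

text \<open>
The triple that corresponds to the two-form \<open>\<omega>\<^sub>j\<close>.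
\<close>

definition omega_syz :: "nat \<Rightarrow> S3" where "omega_syz j = syzygy_of_form (omega m F j)"

lemma prime_F: "j \<in> {1..m} \<Longrightarrow> prime_elem (F j)"
  using irreducible_F irreducible_S_imp_prime_elem by blast

lemma F_nonzero: "j \<in> {1..m} \<Longrightarrow> F j \<noteq> 0"
  by (metis prime_F not_prime_elem_zero)

lemma e_pos:
  assumes j: "j \<in> {1..m}"
  shows "e j > 0"
proof (rule ccontr)
  assume "\<not> e j > 0"
  then obtain a where a: "F j = scalar a"
    using homogeneous_degree_0 homogeneous_F[OF j] by auto
  then have "a \<noteq> 0"
    using F_nonzero[OF j] by auto
  then have "F j dvd 1"
    unfolding a by (intro dvdI[of _ _ "scalar (inverse a)"]) (simp flip: scalar_simps)
  then show False
    using prime_F[OF j] by (simp add: prime_elem_def)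
qed

lemma f_nonzero: "f \<noteq> 0"
  unfolding f_def using F_nonzero by simp

lemma f_eq: "j \<in> {1..m} \<Longrightarrow> f = F j * cofactor j"
  unfolding f_def cofactor_def by (rule prod.remove) auto

lemma homogeneous_f: "homogeneous d f"
  unfolding f_def d_def by (intro homogeneous_prod homogeneous_F)

lemma d_pos: "d > 0"
proof -
  have "e 1 \<le> d"
    unfolding d_def using m_pos by (intro member_le_sum) auto
  then show ?thesis using e_pos[of 1] m_pos by simp
qed

lemma degree_invertible:
  obtains q :: S where "q * of_nat d = 1"
proof
  show "scalar (1 / of_nat d) * of_nat d = 1"
    using d_pos unfolding scalar_of_nat[symmetric] scalar_simps(4)[symmetric] by simp
qed

lemma prime_not_dvd_prod:
  assumes "i \<in> {1..m}" and "A \<subseteq> {1..m} - {i}"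
  shows "\<not> F i dvd prod F A"
proof -
  have "finite A"
    using assms(2) finite_subset by blast
  then show ?thesis
    using assms(2)
  proof (induction A rule: finite_induct)
    case empty
    then show ?case using prime_F[OF assms(1)] by (simp add: prime_elem_def)
  next
    case (insert j A)
    then show ?case
      using prime_F[OF assms(1)] not_dvd_F[OF assms(1), of j] by (auto simp: prime_elem_dvd_mult_iff)
  qed
qed

lemma prime_not_dvd_cofactor: "i \<in> {1..m} \<Longrightarrow> \<not> F i dvd cofactor i"
  unfolding cofactor_def by (rule prime_not_dvd_prod) auto

lemma dvd_cofactor: "i \<in> {1..m} \<Longrightarrow> i \<noteq> j \<Longrightarrow> F i dvd cofactor j"
  unfolding cofactor_def by (intro dvd_prodI) auto

text \<open>
The \<open>F i\<close> are primes none of which divides another.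
\<close>

lemma prod_dvd:
  assumes "A \<subseteq> {1..m}" and "\<And>i. i \<in> A \<Longrightarrow> F i dvd p"
  shows "prod F A dvd p"
proof -
  have "finite A"
    using assms(1) finite_subset by blast
  then show ?thesis
    using assms
  proof (induction A rule: finite_induct)
    case (insert i A)
    then obtain q where q: "p = prod F A * q"
      by (auto elim!: dvdE)
    have "F i dvd q"
      using insert(5)[of i] prime_not_dvd_prod[of i A] insert(2,4) prime_F[of i]
      unfolding q by (auto simp: prime_elem_dvd_mult_iff)
    then show ?case
      unfolding q using insert(1,2) by (auto simp: mult.commute[of "F i"] intro: mult_dvd_mono)
  qed simp
qed

lemma f_dvd: "(\<And>i. i \<in> {1..m} \<Longrightarrow> F i dvd p) \<Longrightarrow> f dvd p"
  unfolding f_def by (rule prod_dvd) auto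

lemma grad_f: "ext_d f = (\<Sum>j\<in>{1..m}. scale3 (cofactor j) (grad j))"
  unfolding f_def cofactor_def by (rule ext_d_prod) simp

lemma euler_F: "j \<in> {1..m} \<Longrightarrow> dot position (grad j) = of_nat (e j) * F j"
  by (rule euler_dot[OF homogeneous_F])

lemma euler_f: "dot position (ext_d f) = of_nat d * f"
  by (rule euler_dot[OF homogeneous_f])

subsection \<open>Transversality\<close>

lemma gradients_independent:
  assumes P: "P \<noteq> (0, 0, 0)" and A: "A \<subseteq> {1..m}" "\<And>j. j \<in> A \<Longrightarrow> eval_at (F j) P = 0"
    and rel: "(\<Sum>j\<in>A. c j * eval_at (partial_x (F j)) P) = 0"
      "(\<Sum>j\<in>A. c j * eval_at (partial_y (F j)) P) = 0"
      "(\<Sum>j\<in>A. c j * eval_at (partial_z (F j)) P) = 0"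
    and j: "j \<in> A"
  shows "c j = 0"
proof -
  define J where "J = {j \<in> {1..m}. eval_at (F j) P = 0}"
  define c' where "c' j = (if j \<in> A then c j else 0)" for j
  have AJ: "A \<subseteq> J" "finite J"
    using A by (auto simp: J_def)
  have sum_J: "(\<Sum>j\<in>J. c' j * g j) = (\<Sum>j\<in>A. c j * g j)" for g
    using AJ by (intro sum.mono_neutral_cong_right) (auto simp: c'_def)
  have "\<forall>c :: nat \<Rightarrow> complex. (\<Sum>j\<in>J. c j * eval_at (partial_x (F j)) P) = 0 \<and>
      (\<Sum>j\<in>J. c j * eval_at (partial_y (F j)) P) = 0 \<and>
      (\<Sum>j\<in>J. c j * eval_at (partial_z (F j)) P) = 0 \<longrightarrow> (\<forall>j\<in>J. c j = 0)"
    using normal_crossing_F P unfolding normal_crossing_def Let_def J_def by blast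
  from this[THEN spec, of c'] have "\<forall>j\<in>J. c' j = 0"
    unfolding sum_J using rel by simp
  then have "c' j = 0"
    using j AJ by blast
  then show ?thesis
    using j by (simp add: c'_def)
qed

definition gradient_at :: "nat \<Rightarrow> point \<Rightarrow> point" where
  "gradient_at j P =
     (eval_at (partial_x (F j)) P, eval_at (partial_y (F j)) P, eval_at (partial_z (F j)) P)"

text \<open>
Where two components meet, the cross product of their gradients is nonzero: otherwise each coordinate
of the two gradients would give a linear relation between them.
\<close>

lemma transversal:
  assumes P: "P \<noteq> (0, 0, 0)" and ij: "i \<in> {1..m}" "j \<in> {1..m}" "i \<noteq> j"
    and zero: "eval_at (F i) P = 0" "eval_at (F j) P = 0"
    and g: "gradient_at i P = (u1, u2, u3)" "gradient_at j P = (v1, v2, v3)"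
    and cross: "u2 * v3 = u3 * v2" "u3 * v1 = u1 * v3" "u1 * v2 = u2 * v1"
  shows False
proof -
  have rel: "\<alpha> = 0 \<and> \<beta> = 0"
    if "\<alpha> * u1 + \<beta> * v1 = 0" "\<alpha> * u2 + \<beta> * v2 = 0" "\<alpha> * u3 + \<beta> * v3 = 0" for \<alpha> \<beta>
  proof -
    have "(if k = i then \<alpha> else \<beta>) = 0" if k: "k \<in> {i, j}" for k
      by (rule gradients_independent[OF P, where A = "{i, j}" and j = k
            and c = "\<lambda>k. if k = i then \<alpha> else \<beta>"])
        (use k ij zero g \<open>\<alpha> * u1 + \<beta> * v1 = 0\<close> \<open>\<alpha> * u2 + \<beta> * v2 = 0\<close>
          \<open>\<alpha> * u3 + \<beta> * v3 = 0\<close> in \<open>auto simp: gradient_at_def\<close>)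
    from this[of i] this[of j] show ?thesis
      using ij(3) by simp
  qed
  have "v1 = 0 \<and> - u1 = 0"
    by (rule rel) (use cross in \<open>simp_all add: algebra_simps\<close>)
  moreover have "v2 = 0 \<and> - u2 = 0"
    by (rule rel) (use cross in \<open>simp_all add: algebra_simps\<close>)
  moreover have "v3 = 0 \<and> - u3 = 0"
    by (rule rel) (use cross in \<open>simp_all add: algebra_simps\<close>)
  ultimately show False
    using rel[of 1 0] by simp
qed

text \<open>
By Euler's formula the three gradients at a common point \<open>P\<close> are orthogonal to \<open>P\<close>, so their
determinant is zero.  Expanding it gives linear relations whose coefficients are the components of
cross products of the gradients; if these all vanish, two of the components are not transversal.
\<close>

lemma no_triple_point:
  assumes ijk: "i \<in> {1..m}" "j \<in> {1..m}" "k \<in> {1..m}" "i \<noteq> j" "i \<noteq> k" "j \<noteq> k"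
    and zero: "eval_at (F i) P = 0" "eval_at (F j) P = 0" "eval_at (F k) P = 0"
  shows "P = (0, 0, 0)"
proof (rule ccontr)
  assume P: "P \<noteq> (0, 0, 0)"
  obtain p1 p2 p3 where p: "P = (p1, p2, p3)" by (cases P)
  obtain u1 u2 u3 where u: "gradient_at i P = (u1, u2, u3)" by (cases "gradient_at i P")
  obtain v1 v2 v3 where v: "gradient_at j P = (v1, v2, v3)" by (cases "gradient_at j P")
  obtain w1 w2 w3 where w: "gradient_at k P = (w1, w2, w3)" by (cases "gradient_at k P")
  have tangent: "p1 * g1 + p2 * g2 + p3 * g3 = 0"
    if "l \<in> {1..m}" "eval_at (F l) P = 0" "gradient_at l P = (g1, g2, g3)" for l g1 g2 g3
    using arg_cong[OF euler[OF homogeneous_F[OF that(1)]], of "\<lambda>p. eval_at p P"] that(2,3)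
    by (simp add: p gradient_at_def)
  note tu = tangent[OF ijk(1) zero(1) u] and tv = tangent[OF ijk(2) zero(2) v]
    and tw = tangent[OF ijk(3) zero(3) w]
  \<comment> \<open>The determinant of the three gradients; it annihilates \<open>P\<close> by the next three identities.\<close>
  define D where "D = u1 * (v2 * w3 - v3 * w2) + u2 * (v3 * w1 - v1 * w3) + u3 * (v1 * w2 - v2 * w1)"
  have "D * p1 = (p1 * u1 + p2 * u2 + p3 * u3) * (v2 * w3 - v3 * w2)
      + (p1 * v1 + p2 * v2 + p3 * v3) * (w2 * u3 - w3 * u2)
      + (p1 * w1 + p2 * w2 + p3 * w3) * (u2 * v3 - u3 * v2)"
    "D * p2 = (p1 * u1 + p2 * u2 + p3 * u3) * (v3 * w1 - v1 * w3)
      + (p1 * v1 + p2 * v2 + p3 * v3) * (w3 * u1 - w1 * u3)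
      + (p1 * w1 + p2 * w2 + p3 * w3) * (u3 * v1 - u1 * v3)"
    "D * p3 = (p1 * u1 + p2 * u2 + p3 * u3) * (v1 * w2 - v2 * w1)
      + (p1 * v1 + p2 * v2 + p3 * v3) * (w1 * u2 - w2 * u1)
      + (p1 * w1 + p2 * w2 + p3 * w3) * (u1 * v2 - u2 * v1)"
    unfolding D_def by (simp_all add: algebra_simps)
  then have "D = 0"
    using P unfolding tu tv tw by (auto simp: p)
  have rel: "\<gamma> = 0"
    if "\<alpha> * u1 + \<beta> * v1 + \<gamma> * w1 = 0" "\<alpha> * u2 + \<beta> * v2 + \<gamma> * w2 = 0"
      "\<alpha> * u3 + \<beta> * v3 + \<gamma> * w3 = 0" for \<alpha> \<beta> \<gamma>
  proof -
    have "(if k = i then \<alpha> else if k = j then \<beta> else \<gamma>) = 0"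
      by (rule gradients_independent[OF P, where A = "{i, j, k}" and j = k
            and c = "\<lambda>l. if l = i then \<alpha> else if l = j then \<beta> else \<gamma>"])
        (use ijk zero u v w that in \<open>auto simp: gradient_at_def add.assoc\<close>)
    then show ?thesis
      using ijk by simp
  qed
  have det: "(v2 * w3 - v3 * w2) * u1 + (w2 * u3 - w3 * u2) * v1 + (u2 * v3 - u3 * v2) * w1 = D"
    "(v2 * w3 - v3 * w2) * u2 + (w2 * u3 - w3 * u2) * v2 + (u2 * v3 - u3 * v2) * w2 = 0"
    "(v2 * w3 - v3 * w2) * u3 + (w2 * u3 - w3 * u2) * v3 + (u2 * v3 - u3 * v2) * w3 = 0"
    "(v3 * w1 - v1 * w3) * u1 + (w3 * u1 - w1 * u3) * v1 + (u3 * v1 - u1 * v3) * w1 = 0"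
    "(v3 * w1 - v1 * w3) * u2 + (w3 * u1 - w1 * u3) * v2 + (u3 * v1 - u1 * v3) * w2 = D"
    "(v3 * w1 - v1 * w3) * u3 + (w3 * u1 - w1 * u3) * v3 + (u3 * v1 - u1 * v3) * w3 = 0"
    "(v1 * w2 - v2 * w1) * u1 + (w1 * u2 - w2 * u1) * v1 + (u1 * v2 - u2 * v1) * w1 = 0"
    "(v1 * w2 - v2 * w1) * u2 + (w1 * u2 - w2 * u1) * v2 + (u1 * v2 - u2 * v1) * w2 = 0"
    "(v1 * w2 - v2 * w1) * u3 + (w1 * u2 - w2 * u1) * v3 + (u1 * v2 - u2 * v1) * w3 = D"
    unfolding D_def by (simp_all add: algebra_simps)
  have "u2 * v3 - u3 * v2 = 0"
    by (rule rel[OF det(1-3)[unfolded \<open>D = 0\<close>]])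
  moreover have "u3 * v1 - u1 * v3 = 0"
    by (rule rel[OF det(4-6)[unfolded \<open>D = 0\<close>]])
  moreover have "u1 * v2 - u2 * v1 = 0"
    by (rule rel[OF det(7-9)[unfolded \<open>D = 0\<close>]])
  ultimately show False
    using transversal[OF P ijk(1,2,4) zero(1,2) u v] by simp
qed

text \<open>
Comparing \<open>\<beta> = ci grad i\<close> modulo \<open>F i\<close> with \<open>\<beta> = cj grad j\<close> modulo \<open>F j\<close> gives
\<open>cj (grad i \<times> grad j) = 0\<close> modulo \<open>(F i, F j)\<close>.  By transversality the components of the cross product
have no common zero with \<open>F i\<close> and \<open>F j\<close>, so \<open>saturation\<close> applies.
\<close>

lemma multiplier_in_ideal2:
  assumes ij: "i \<in> {1..m}" "j \<in> {1..m}" "i \<noteq> j"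
    and ci: "dvd3 (F i) (\<beta> - scale3 ci (grad i))" and cj: "dvd3 (F j) (\<beta> - scale3 cj (grad j))"
  shows "cj \<in> ideal2 (F j) (F i)"
proof -
  obtain \<eta> \<theta> where \<eta>: "\<beta> - scale3 ci (grad i) = scale3 (F i) \<eta>"
    and \<theta>: "\<beta> - scale3 cj (grad j) = scale3 (F j) \<theta>"
    using ci cj unfolding dvd3_def by blast
  have "scale3 cj (cross (grad i) (grad j)) = cross (grad i) (scale3 cj (grad j))"
    by (simp add: cross_simps)
  also have "scale3 cj (grad j) = (scale3 ci (grad i) + scale3 (F i) \<eta>) - scale3 (F j) \<theta>"
    unfolding \<eta>[symmetric] \<theta>[symmetric] by simp
  finally have eq: "scale3 cj (cross (grad i) (grad j))
      = scale3 (F i) (cross (grad i) \<eta>) - scale3 (F j) (cross (grad i) \<theta>)"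
    by (simp add: cross_simps scale3_simps)
  obtain x y z where xyz: "cross (grad i) (grad j) = (x, y, z)"
    by (cases "cross (grad i) (grad j)")
  obtain a b c where abc: "cross (grad i) \<eta> = (a, b, c)"
    by (cases "cross (grad i) \<eta>")
  obtain a' b' c' where abc': "cross (grad i) \<theta> = (a', b', c')"
    by (cases "cross (grad i) \<theta>")
  have xyz_def:
    "x = partial_y (F i) * partial_z (F j) - partial_z (F i) * partial_y (F j)"
    "y = partial_z (F i) * partial_x (F j) - partial_x (F i) * partial_z (F j)"
    "z = partial_x (F i) * partial_y (F j) - partial_y (F i) * partial_x (F j)"
    using xyz by (auto simp: ext_d_def)
  show ?thesis
  proof (rule saturation[OF prime_F[OF ij(2)] _ homogeneous_F[OF ij(2)] homogeneous_F[OF ij(1)],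
        where H = "{x, y, z}"])
    show "\<not> F j dvd F i"
      using not_dvd_F ij by blast
    have "homogeneous (e i - 1 + (e j - 1)) x" "homogeneous (e i - 1 + (e j - 1)) y"
        "homogeneous (e i - 1 + (e j - 1)) z"
      unfolding xyz_def
      by (intro homogeneous_diff homogeneous_mult homogeneous_partial homogeneous_F ij)+
    then show "\<exists>k. homogeneous k h" if "h \<in> {x, y, z}" for h
      using that by blast
    have "cj * x = F i * a - F j * a'" "cj * y = F i * b - F j * b'" "cj * z = F i * c - F j * c'"
      using eq unfolding xyz abc abc' by simp_all
    moreover have "F i * s - F j * t \<in> ideal2 (F j) (F i)" for s t
      by (intro ideal2_rules(4,6) ideal2_generators)
    ultimately have "x * cj \<in> ideal2 (F j) (F i)" "y * cj \<in> ideal2 (F j) (F i)"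
        "z * cj \<in> ideal2 (F j) (F i)"
      by (metis mult.commute)+
    then show "h * cj \<in> ideal2 (F j) (F i)" if "h \<in> {x, y, z}" for h
      using that by blast
    show "\<exists>h\<in>{x, y, z}. eval_at h P \<noteq> 0"
      if "P \<noteq> (0, 0, 0)" "eval_at (F j) P = 0" "eval_at (F i) P = 0" for P
    proof (rule ccontr)
      assume "\<not> ?thesis"
      then have "eval_at x P = 0" "eval_at y P = 0" "eval_at z P = 0"
        by auto
      then have
        "eval_at (partial_y (F i)) P * eval_at (partial_z (F j)) P
           = eval_at (partial_z (F i)) P * eval_at (partial_y (F j)) P"
        "eval_at (partial_z (F i)) P * eval_at (partial_x (F j)) P
           = eval_at (partial_x (F i)) P * eval_at (partial_z (F j)) P"
        "eval_at (partial_x (F i)) P * eval_at (partial_y (F j)) P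
           = eval_at (partial_y (F i)) P * eval_at (partial_x (F j)) P"
        unfolding xyz_def by simp_all
      then show False
        by (rule transversal[OF that(1) ij that(3,2) gradient_at_def gradient_at_def])
    qed
  qed
qed

text \<open>
This is \<open>saturation\<close> with the single multiplier \<open>F i\<close>, since three components have no common zero.
\<close>

lemma component_regular_mod_pair:
  assumes ijk: "i \<in> {1..m}" "j \<in> {1..m}" "k \<in> {1..m}" "i \<noteq> j" "i \<noteq> k" "j \<noteq> k"
    and mem: "F i * u \<in> ideal2 (F j) (F k)"
  shows "u \<in> ideal2 (F j) (F k)"
proof (rule saturation[OF prime_F[OF ijk(2)] _ homogeneous_F[OF ijk(2)] homogeneous_F[OF ijk(3)],
      where H = "{F i}"])
  show "\<not> F j dvd F k"
    using not_dvd_F ijk by blast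
  show "\<exists>k. homogeneous k h" if "h \<in> {F i}" for h
    using that homogeneous_F[OF ijk(1)] by blast
  show "h * u \<in> ideal2 (F j) (F k)" if "h \<in> {F i}" for h
    using that mem by simp
  show "\<exists>h\<in>{F i}. eval_at h P \<noteq> 0"
    if "P \<noteq> (0, 0, 0)" "eval_at (F j) P = 0" "eval_at (F k) P = 0" for P
    using that no_triple_point[OF ijk, of P] by auto
qed

lemma prod_regular_mod_pair:
  assumes jk: "j \<in> {1..m}" "k \<in> {1..m}" "j \<noteq> k" and A: "A \<subseteq> {1..m} - {j, k}"
    and mem: "prod F A * u \<in> ideal2 (F j) (F k)"
  shows "u \<in> ideal2 (F j) (F k)"
proof -
  have "finite A"
    using A finite_subset by blast
  then show ?thesis
    using A mem
  proof (induction A arbitrary: u rule: finite_induct)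
    case (insert i A)
    have "prod F A * (F i * u) \<in> ideal2 (F j) (F k)"
      using insert(1,2,5) by (simp add: ac_simps)
    then have "F i * u \<in> ideal2 (F j) (F k)"
      using insert(3,4) by blast
    then show ?case
      using component_regular_mod_pair[of i j k] insert(4) jk by blast
  qed simp
qed

text \<open>
Add one factor \<open>F k\<close> at a time: if \<open>c = a F j + b \<Prod>A\<close> also lies in \<open>(F j, F k)\<close>, then so does
\<open>b \<Prod>A\<close>, and \<open>\<Prod>A\<close> is a nonzerodivisor modulo \<open>(F j, F k)\<close>.
\<close>

lemma ideal2_intersection:
  assumes j: "j \<in> {1..m}" and A: "A \<subseteq> {1..m} - {j}"
    and mem: "\<And>i. i \<in> A \<Longrightarrow> c \<in> ideal2 (F j) (F i)"
  shows "c \<in> ideal2 (F j) (prod F A)"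
proof -
  have "finite A"
    using A finite_subset by blast
  then show ?thesis
    using A mem
  proof (induction A rule: finite_induct)
    case empty
    show ?case
      using dvd_in_ideal2(2)[of 1 c "F j"] by simp
  next
    case (insert k A)
    then have "c \<in> ideal2 (F j) (prod F A)"
      by blast
    then obtain a b where c: "c = a * F j + b * prod F A"
      by (rule ideal2E)
    have "prod F A * b = c - a * F j"
      by (simp add: c mult.commute)
    also have "\<dots> \<in> ideal2 (F j) (F k)"
      using insert(5)[of k] by (intro ideal2_rules(3,6) ideal2_generators) simp
    finally have "b \<in> ideal2 (F j) (F k)"
      using prod_regular_mod_pair[of j k A b] insert(2,4) j by blast
    then obtain b1 b2 where "b = b1 * F j + b2 * F k"
      by (rule ideal2E)
    then have "c = (a + b1 * prod F A) * F j + b2 * (F k * prod F A)"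
      unfolding c by (simp add: algebra_simps)
    then show ?case
      using insert(1,2) unfolding ideal2_def by auto
  qed
qed

subsection \<open>Logarithmic one-forms\<close>

text \<open>
Read \<open>\<beta>/f\<close> as a one-form with simple poles along the curve.  The conclusion says that it is a
polynomial form plus a combination of the \<open>dF j/F j\<close>.  Along \<open>F j = 0\<close> one has \<open>\<beta> = c j grad j\<close>; by
transversality \<open>c j\<close> lies in \<open>(F j, F i)\<close> for all \<open>i \<noteq> j\<close>, hence in \<open>(F j, cofactor j)\<close>.  So the residue
\<open>c j / cofactor j\<close> is represented by a polynomial \<open>a j\<close>, and what remains after subtracting these
residues is divisible by every \<open>F j\<close>.
\<close>

lemma logarithmic_form_decomposition:
  assumes \<beta>: "\<And>j. j \<in> {1..m} \<Longrightarrow> dvd3 (F j) (cross (grad j) \<beta>)"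
  obtains a \<eta> where "\<beta> = (\<Sum>j\<in>{1..m}. scale3 (a j * cofactor j) (grad j)) + scale3 f \<eta>"
proof -
  have "\<exists>c. dvd3 (F j) (\<beta> - scale3 c (grad j))" if j: "j \<in> {1..m}" for j
    using form_proportional_along_smooth_curve[OF prime_F[OF j] homogeneous_F[OF j] e_pos[OF j]
        smooth_F[OF j] \<beta>[OF j]] by blast
  then obtain c where c: "dvd3 (F j) (\<beta> - scale3 (c j) (grad j))" if "j \<in> {1..m}" for j
    by metis
  have "\<exists>a b. c j = a * F j + b * cofactor j" if j: "j \<in> {1..m}" for j
  proof -
    have "c j \<in> ideal2 (F j) (cofactor j)"
      unfolding cofactor_def
    proof (rule ideal2_intersection[OF j])
      fix i assume "i \<in> {1..m} - {j}"
      then show "c j \<in> ideal2 (F j) (F i)"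
        using multiplier_in_ideal2[of i j \<beta> "c i" "c j"] c j by blast
    qed simp
    then show ?thesis
      unfolding ideal2_def by blast
  qed
  then obtain b a where ca: "c j = b j * F j + a j * cofactor j" if "j \<in> {1..m}" for j
    by metis
  define \<theta> where "\<theta> = \<beta> - (\<Sum>j\<in>{1..m}. scale3 (a j * cofactor j) (grad j))"
  have "dvd3 (F i) \<theta>" if i: "i \<in> {1..m}" for i
  proof -
    have "\<theta> = (\<beta> - scale3 (a i * cofactor i) (grad i))
        - (\<Sum>j\<in>{1..m}-{i}. scale3 (a j * cofactor j) (grad j))"
      unfolding \<theta>_def by (subst sum.remove[of _ i]) (use i in \<open>simp_all add: algebra_simps\<close>)
    moreover have "\<beta> - scale3 (a i * cofactor i) (grad i)
        = (\<beta> - scale3 (c i) (grad i)) + scale3 (b i * F i) (grad i)"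
      unfolding ca[OF i] by (simp add: scale3_simps)
    moreover have "dvd3 (F i) (\<Sum>j\<in>{1..m}-{i}. scale3 (a j * cofactor j) (grad j))"
      using dvd_cofactor[OF i] by (intro dvd3_sum dvd3_scale) auto
    ultimately show ?thesis
      using c[OF i] by (auto intro!: dvd3_diff dvd3_add dvd3_scale)
  qed
  then have "dvd3 f \<theta>"
    using f_dvd by (cases \<theta>) (simp add: dvd3_iff)
  then obtain \<eta> where "\<theta> = scale3 f \<eta>"
    unfolding dvd3_def by blast
  then show ?thesis
    by (intro that[of a \<eta>]) (simp add: \<theta>_def algebra_simps)
qed

subsection \<open>The generators\<close>

lemma cofactor_cofactor:
  assumes ij: "i \<in> {1..m}" "j \<in> {1..m}" "i \<noteq> j"
  shows "f div (F i * F j) = (\<Prod>k\<in>{1..m}-{i, j}. F k)"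
    and "F j * (f div (F i * F j)) = cofactor i"
proof -
  have "{1..m} - {i} - {j} = {1..m} - {i, j}"
    by blast
  then have cof: "cofactor i = F j * (\<Prod>k\<in>{1..m}-{i, j}. F k)"
    unfolding cofactor_def using ij by (subst prod.remove[of _ j]) auto
  then have "f = (F i * F j) * (\<Prod>k\<in>{1..m}-{i, j}. F k)"
    using f_eq[OF ij(1)] by (simp add: mult.assoc)
  then show div: "f div (F i * F j) = (\<Prod>k\<in>{1..m}-{i, j}. F k)"
    using F_nonzero[OF ij(1)] F_nonzero[OF ij(2)]
    by (metis mult_eq_0_iff nonzero_mult_div_cancel_left)
  show "F j * (f div (F i * F j)) = cofactor i"
    unfolding div cof ..
qed

lemma omega_syz_eq: "omega_syz j = (\<Sum>i\<in>{1..m}-{j}. scale3 (f div (F i * F j)) (cross (grad i) (grad j)))"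
  unfolding omega_syz_def omega_def curve_poly_def f_def[symmetric] syzygy_of_form_sum
  by (simp add: syzygy_of_form_scale3 syzygy_of_wedge)

text \<open>
This is the equation \<open>f\<^sub>j \<omega>\<^sub>j = df \<and> df\<^sub>j\<close>.  It makes \<open>df \<and> df\<^sub>j\<close> superfluous as a generator when \<open>f\<^sub>j\<close> is
linear.
\<close>

lemma F_mult_omega_syz:
  assumes j: "j \<in> {1..m}"
  shows "scale3 (F j) (omega_syz j) = cross (ext_d f) (grad j)"
proof -
  have "scale3 (F j) (omega_syz j) = (\<Sum>i\<in>{1..m}-{j}. cross (scale3 (cofactor i) (grad i)) (grad j))"
    unfolding omega_syz_eq scale3_sum
    using cofactor_cofactor(2) j by (intro sum.cong refl) (simp add: scale3_simps cross_simps)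
  also have "\<dots> = (\<Sum>i\<in>{1..m}. cross (scale3 (cofactor i) (grad i)) (grad j))"
    using j by (subst (2) sum.remove[of _ j]) (simp_all add: cross_simps scale3_simps)
  also have "\<dots> = cross (ext_d f) (grad j)"
    unfolding grad_f cross_sum_left ..
  finally show ?thesis .
qed

lemma f_mult_omega_syz:
  assumes j: "j \<in> {1..m}"
  shows "scale3 f (omega_syz j) = scale3 (cofactor j) (cross (ext_d f) (grad j))"
  unfolding F_mult_omega_syz[OF j, symmetric] scale3_simps using f_eq[OF j] by (simp add: mult.commute)

text \<open>
\<open>f \<omega>\<^sub>j\<close> is the \<open>j\<close>-th summand of \<open>df \<and> df\<close> after expanding the second factor by the product rule.
This relation makes \<open>\<omega>\<^sub>m\<close> superfluous as a generator.
\<close>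

lemma sum_omega_syz: "(\<Sum>j\<in>{1..m}. omega_syz j) = 0"
proof -
  have "scale3 f (\<Sum>j\<in>{1..m}. omega_syz j) = (\<Sum>j\<in>{1..m}. cross (ext_d f) (scale3 (cofactor j) (grad j)))"
    unfolding scale3_sum by (intro sum.cong refl) (simp add: f_mult_omega_syz cross_simps)
  also have "\<dots> = cross (ext_d f) (ext_d f)"
    unfolding cross_sum[symmetric] grad_f[symmetric] ..
  also have "\<dots> = scale3 f 0"
    by (simp add: cross_simps scale3_simps)
  finally show ?thesis
    unfolding scale3_cancel[OF f_nonzero] .
qed

lemma omega_syz_in_D0: "j \<in> {1..m} \<Longrightarrow> omega_syz j \<in> D0 f"
proof -
  assume j: "j \<in> {1..m}"
  have "F j * dot (omega_syz j) (ext_d f) = dot (scale3 (F j) (omega_syz j)) (ext_d f)"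
    by (simp add: dot_simps)
  also have "\<dots> = 0"
    unfolding F_mult_omega_syz[OF j] by (rule dot_cross_self)
  finally show ?thesis
    using F_nonzero[OF j] by (simp add: D0_iff_dot)
qed

lemma cross_in_D0: "cross (ext_d f) v \<in> D0 f"
  unfolding D0_iff_dot by (rule dot_cross_self)

lemma subspace_D0: "S3.subspace (D0 f)"
  by (rule S3.subspaceI)
    (simp_all add: D0_iff_dot dot_simps)

text \<open>
Modulo \<open>F j\<close> only one summand of the gradient of \<open>f\<close> survives, and its coefficient is prime to \<open>F j\<close>.
\<close>

lemma syzygy_restricts_to_components:
  assumes s: "s \<in> D0 f" and j: "j \<in> {1..m}"
  shows "F j dvd dot s (grad j)"
proof -
  have "0 = (\<Sum>i\<in>{1..m}. cofactor i * dot s (grad i))"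
    using s unfolding D0_iff_dot grad_f dot_sum by (simp add: dot_simps)
  also have "\<dots> = cofactor j * dot s (grad j) + (\<Sum>i\<in>{1..m}-{j}. cofactor i * dot s (grad i))"
    using j by (simp add: sum.remove)
  finally have "cofactor j * dot s (grad j) = - (\<Sum>i\<in>{1..m}-{j}. cofactor i * dot s (grad i))"
    by (simp add: eq_neg_iff_add_eq_0)
  moreover have "F j dvd (\<Sum>i\<in>{1..m}-{j}. cofactor i * dot s (grad i))"
    using dvd_cofactor[OF j] by (intro dvd_sum dvd_mult2) auto
  ultimately have "F j dvd cofactor j * dot s (grad j)"
    by simp
  then show ?thesis
    using prime_F[OF j] prime_not_dvd_cofactor[OF j] by (simp add: prime_elem_dvd_mult_iff)
qed

text \<open>
The form \<open>\<beta> = s \<times> position\<close> determines \<open>s\<close>, since \<open>grad f \<times> \<beta> = s (grad f \<cdot> position) - position (grad f \<cdot> s)\<close>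
is \<open>d f s\<close> by Euler's formula.  The same identity with \<open>grad j\<close> shows \<open>grad j \<times> \<beta> = 0\<close> modulo \<open>F j\<close>, so
\<open>\<beta>\<close> decomposes as a logarithmic form, and multiplying the decomposition by \<open>grad f\<close> gives the claim.
\<close>

lemma syzygy_decomposition:
  assumes s: "s \<in> D0 f"
  obtains a \<eta> where "s = (\<Sum>j\<in>{1..m}. scale3 (a j) (omega_syz j)) + cross (ext_d f) \<eta>"
proof -
  define \<beta> where "\<beta> = cross s position"
  have "dvd3 (F j) (cross (grad j) \<beta>)" if j: "j \<in> {1..m}" for j
    unfolding \<beta>_def cross_cross
    using euler_F[OF j] syzygy_restricts_to_components[OF s j]
    by (intro dvd3_diff dvd3_scale) (simp_all add: dot_commute[of "grad j"])
  then obtain a \<eta> where \<beta>: "\<beta> = (\<Sum>j\<in>{1..m}. scale3 (a j * cofactor j) (grad j)) + scale3 f \<eta>"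
    using logarithmic_form_decomposition by blast
  have "scale3 f (scale3 (of_nat d) s) = cross (ext_d f) \<beta>"
    unfolding \<beta>_def cross_cross using s euler_f
    by (simp add: D0_iff_dot dot_commute[of "ext_d f"] scale3_simps mult.commute)
  also have "\<dots> = (\<Sum>j\<in>{1..m}. scale3 (a j) (scale3 f (omega_syz j))) + scale3 f (cross (ext_d f) \<eta>)"
    unfolding \<beta> cross_simps cross_sum
    by (intro arg_cong2[of _ _ _ _ "(+)"] sum.cong refl) (simp_all add: f_mult_omega_syz cross_simps scale3_simps)
  also have "\<dots> = scale3 f ((\<Sum>j\<in>{1..m}. scale3 (a j) (omega_syz j)) + cross (ext_d f) \<eta>)"
    by (simp add: scale3_simps scale3_sum mult.commute)
  finally have ds: "scale3 (of_nat d) s = (\<Sum>j\<in>{1..m}. scale3 (a j) (omega_syz j)) + cross (ext_d f) \<eta>"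
    unfolding scale3_cancel[OF f_nonzero] .
  obtain q :: S where "q * of_nat d = 1"
    by (rule degree_invertible)
  then have "s = scale3 q (scale3 (of_nat d) s)"
    by (simp add: scale3_simps)
  also have "\<dots> = (\<Sum>j\<in>{1..m}. scale3 (q * a j) (omega_syz j)) + cross (ext_d f) (scale3 q \<eta>)"
    unfolding ds by (simp add: scale3_simps scale3_sum cross_simps)
  finally show ?thesis
    by (rule that)
qed

lemma omega_syz_mem_subspace:
  assumes N: "S3.subspace N" and omega_syz: "omega_syz ` {1..m-1} \<subseteq> N" and j: "j \<in> {1..m}"
  shows "omega_syz j \<in> N"
proof (cases "j = m")
  case True
  have "{1..m} = insert m {1..m-1}"
    using m_pos by auto
  then have "omega_syz m + (\<Sum>j\<in>{1..m-1}. omega_syz j) = 0"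
    using sum_omega_syz m_pos by simp
  then have "omega_syz m = - (\<Sum>j\<in>{1..m-1}. omega_syz j)"
    by (simp add: eq_neg_iff_add_eq_0)
  also have "\<dots> \<in> N"
    using omega_syz by (intro S3.subspace_neg[OF N] S3.subspace_sum[OF N]) auto
  finally show ?thesis using True by simp
next
  case False
  then show ?thesis using omega_syz j by auto
qed

lemma span_eq_D0:
  assumes V: "\<And>v. v \<in> {(1, 0, 0), (0, 1, 0), (0, 0, 1)} \<Longrightarrow>
      cross (ext_d f) v \<in> S3.span (omega_syz ` {1..m-1} \<union> cross (ext_d f) ` T)"
  shows "S3.span (omega_syz ` {1..m-1} \<union> cross (ext_d f) ` T) = D0 f"
proof
  show "S3.span (omega_syz ` {1..m-1} \<union> cross (ext_d f) ` T) \<subseteq> D0 f"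
    by (intro S3.span_minimal subspace_D0) (auto intro!: omega_syz_in_D0 cross_in_D0)
  show "D0 f \<subseteq> S3.span (omega_syz ` {1..m-1} \<union> cross (ext_d f) ` T)" (is "_ \<subseteq> ?N")
  proof
    fix s assume "s \<in> D0 f"
    then obtain a \<eta> where s: "s = (\<Sum>j\<in>{1..m}. scale3 (a j) (omega_syz j)) + cross (ext_d f) \<eta>"
      by (rule syzygy_decomposition)
    have N: "S3.subspace ?N"
      by (rule S3.subspace_span)
    obtain x y z where \<eta>: "\<eta> = (x, y, z)"
      by (cases \<eta>)
    have "cross (ext_d f) \<eta> = scale3 x (cross (ext_d f) (1, 0, 0))
        + scale3 y (cross (ext_d f) (0, 1, 0)) + scale3 z (cross (ext_d f) (0, 0, 1))"
      unfolding \<eta> by (simp add: ext_d_def algebra_simps)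
    also have "\<dots> \<in> ?N"
      by (intro S3.span_add S3.span_scale V) auto
    finally have "cross (ext_d f) \<eta> \<in> ?N" .
    moreover have "omega_syz j \<in> ?N" if "j \<in> {1..m}" for j
      by (rule omega_syz_mem_subspace[OF N _ that]) (auto intro: S3.span_base)
    ultimately show "s \<in> ?N"
      unfolding s by (intro S3.span_add S3.span_sum S3.span_scale) auto
  qed
qed

section \<open>Relations between the generators\<close>

text \<open>
A relation says that the logarithmic form \<open>W/f = \<Sum> a\<^sub>j df\<^sub>j/f\<^sub>j + \<tau>\<close> satisfies \<open>df \<and> W = 0\<close>.  Contraction
with the Euler field turns this into \<open>W = h df\<close> for a polynomial \<open>h\<close>, that is
\<open>\<Sum> (a\<^sub>j - h) df\<^sub>j/f\<^sub>j + \<tau> = 0\<close>.  All residues of this form vanish, so \<open>f\<^sub>j\<close> divides \<open>a\<^sub>j - h\<close>.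
\<close>

lemma relation_structure:
  assumes rel: "(\<Sum>j\<in>{1..m}. scale3 (a j) (omega_syz j)) + cross (ext_d f) \<tau> = 0"
  obtains h k where "\<And>j. j \<in> {1..m} \<Longrightarrow> a j = h + F j * k j"
    and "(\<Sum>j\<in>{1..m}. scale3 (k j) (grad j)) + \<tau> = 0"
proof -
  define W where "W = (\<Sum>j\<in>{1..m}. scale3 (a j * cofactor j) (grad j)) + scale3 f \<tau>"
  have "cross (ext_d f) W
      = (\<Sum>j\<in>{1..m}. scale3 (a j) (scale3 f (omega_syz j))) + scale3 f (cross (ext_d f) \<tau>)"
    unfolding W_def cross_simps cross_sum
    by (intro arg_cong2[of _ _ _ _ "(+)"] sum.cong refl) (simp_all add: f_mult_omega_syz cross_simps scale3_simps)
  also have "\<dots> = scale3 f ((\<Sum>j\<in>{1..m}. scale3 (a j) (omega_syz j)) + cross (ext_d f) \<tau>)"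
    by (simp add: scale3_simps scale3_sum mult.commute)
  also have "\<dots> = 0"
    unfolding rel by (rule scale3_simps)
  finally have W0: "cross (ext_d f) W = 0" .
  define H where "H = (\<Sum>j\<in>{1..m}. a j * of_nat (e j)) + dot position \<tau>"
  have "dot position W = (\<Sum>j\<in>{1..m}. f * (a j * of_nat (e j))) + f * dot position \<tau>"
    unfolding W_def dot_simps dot_sum
    by (intro arg_cong2[of _ _ _ _ "(+)"] sum.cong refl) (simp_all add: euler_F f_eq ac_simps)
  then have rW: "dot position W = f * H"
    by (simp add: H_def sum_distrib_left distrib_left)
  have "0 = scale3 (dot position W) (ext_d f) - scale3 (dot position (ext_d f)) W"
    unfolding cross_cross[symmetric] W0 by (simp add: cross_simps)
  then have "scale3 f (scale3 (of_nat d) W) = scale3 f (scale3 H (ext_d f))"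
    unfolding rW euler_f by (simp add: scale3_simps mult.commute)
  then have dW: "scale3 (of_nat d) W = scale3 H (ext_d f)"
    unfolding scale3_cancel[OF f_nonzero] .
  obtain q :: S where "q * of_nat d = 1"
    by (rule degree_invertible)
  then have "W = scale3 q (scale3 (of_nat d) W)"
    by (simp add: scale3_simps)
  also have "\<dots> = scale3 (q * H) (ext_d f)"
    unfolding dW by (simp add: scale3_simps)
  finally have W: "W = scale3 (q * H) (ext_d f)" .
  define h where "h = q * H"
  have zero: "(\<Sum>j\<in>{1..m}. scale3 ((a j - h) * cofactor j) (grad j)) + scale3 f \<tau> = 0"
  proof -
    have "(\<Sum>j\<in>{1..m}. scale3 ((a j - h) * cofactor j) (grad j)) + scale3 f \<tau>
        = W - scale3 h (ext_d f)"
      unfolding W_def grad_f scale3_sum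
      by (simp add: scale3_simps left_diff_distrib sum_subtractf)
    then show ?thesis
      using W by (simp add: h_def)
  qed
  have "F i dvd a i - h" if i: "i \<in> {1..m}" for i
  proof -
    define R where "R = (\<Sum>j\<in>{1..m}-{i}. scale3 ((a j - h) * cofactor j) (grad j)) + scale3 f \<tau>"
    have "scale3 ((a i - h) * cofactor i) (grad i) + R = 0"
      using zero i unfolding R_def by (simp add: sum.remove add.assoc)
    then have "scale3 ((a i - h) * cofactor i) (grad i) = 0 - R"
      by (simp add: eq_neg_iff_add_eq_0)
    moreover have "dvd3 (F i) R"
      unfolding R_def using dvd_cofactor[OF i] f_eq[OF i]
      by (intro dvd3_add dvd3_sum dvd3_scale) auto
    ultimately have *: "dvd3 (F i) (scale3 ((a i - h) * cofactor i) (grad i))"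
      using dvd3_diff[OF dvd3_0] by simp
    show ?thesis
    proof (rule ccontr)
      assume "\<not> F i dvd a i - h"
      then have "\<not> F i dvd (a i - h) * cofactor i"
        using prime_F[OF i] prime_not_dvd_cofactor[OF i] by (simp add: prime_elem_dvd_mult_iff)
      then have "dvd3 (F i) (grad i)"
        using * prime_F[OF i] by (auto simp: ext_d_def dvd3_iff prime_elem_dvd_mult_iff)
      then show False
        using exists_partial_not_divisible[OF prime_F[OF i] homogeneous_F[OF i] e_pos[OF i]] by simp
    qed
  qed
  then have "\<exists>k. a i = h + F i * k" if "i \<in> {1..m}" for i
    using that by (metis dvdE add_diff_cancel_left' diff_add_cancel add.commute)
  then obtain k where k: "a i = h + F i * k i" if "i \<in> {1..m}" for i
    by metis
  have "scale3 f ((\<Sum>j\<in>{1..m}. scale3 (k j) (grad j)) + \<tau>)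
    = (\<Sum>j\<in>{1..m}. scale3 ((a j - h) * cofactor j) (grad j)) + scale3 f \<tau>"
    unfolding scale3_simps scale3_sum
    by (intro arg_cong2[of _ _ _ _ "(+)"] sum.cong refl) (simp_all add: k f_eq ac_simps)
  then have "scale3 f ((\<Sum>j\<in>{1..m}. scale3 (k j) (grad j)) + \<tau>) = scale3 f 0"
    unfolding zero by (simp add: scale3_simps)
  then have "(\<Sum>j\<in>{1..m}. scale3 (k j) (grad j)) + \<tau> = 0"
    unfolding scale3_cancel[OF f_nonzero] .
  then show ?thesis
    using k that by blast
qed

end

section \<open>Exponents\<close>

lemma homogeneous3_scale3:
  "homogeneous n p \<Longrightarrow> homogeneous3 k v \<Longrightarrow> homogeneous3 (n + k) (scale3 p v)"
  by (cases v) (simp add: homogeneous_mult)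

lemma homogeneous3_cross:
  "homogeneous3 n u \<Longrightarrow> homogeneous3 k v \<Longrightarrow> homogeneous3 (n + k) (cross u v)"
  by (cases u; cases v) (simp add: homogeneous_mult homogeneous_diff)

lemma homogeneous3_sum:
  assumes "\<And>i. i \<in> A \<Longrightarrow> homogeneous3 n (g i)"
  shows "homogeneous3 n (sum g A)"
proof -
  have "homogeneous3 n (u + v)" if "homogeneous3 n u" "homogeneous3 n v" for u v
    using that by (cases u; cases v) (simp add: homogeneous_add)
  then show ?thesis
    using assms
    by (induction A rule: infinite_finite_induct) (simp_all add: zero_prod_def)
qed

lemma homogeneous3_ext_d: "homogeneous n p \<Longrightarrow> homogeneous3 (n - 1) (ext_d p)"
  using homogeneous_partial[of n p] by (simp add: ext_d_def)

lemma span_image_combination: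
  assumes "finite K" and v: "v \<in> S3.span (g ` K)"
  obtains q where "v = (\<Sum>k\<in>K. scale3 (q k) (g k))"
proof -
  let ?P = "\<lambda>v. \<exists>q. v = (\<Sum>k\<in>K. scale3 (q k) (g k))"
  have "?P v"
    using v
  proof (induction rule: S3.span_induct)
    case (step v)
    then obtain i where "i \<in> K" "v = g i"
      by blast
    then have "v = (\<Sum>k\<in>K. scale3 (if k = i then 1 else 0) (g k))"
      using \<open>finite K\<close> by (subst sum.remove[of _ i]) (auto simp: scale3_simps)
    then show ?case by (rule exI[of _ "\<lambda>k. if k = i then 1 else 0"])
  next
    case base
    show ?case
    proof (rule S3.subspaceI, unfold mem_Collect_eq)
      have "0 = (\<Sum>k\<in>K. scale3 0 (g k))"
        by (simp add: scale3_simps)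
      then show "?P 0" by (rule exI[of _ "\<lambda>k. 0"])
    next
      fix u w assume "?P u" "?P w"
      then obtain q q' where "u = (\<Sum>k\<in>K. scale3 (q k) (g k))" "w = (\<Sum>k\<in>K. scale3 (q' k) (g k))"
        by blast
      then have "u + w = (\<Sum>k\<in>K. scale3 (q k + q' k) (g k))"
        by (simp add: scale3_simps sum.distrib)
      then show "?P (u + w)" by (rule exI[of _ "\<lambda>k. q k + q' k"])
    next
      fix c u assume "?P u"
      then obtain q where "u = (\<Sum>k\<in>K. scale3 (q k) (g k))"
        by blast
      then have "scale3 c u = (\<Sum>k\<in>K. scale3 (c * q k) (g k))"
        by (simp add: scale3_sum scale3_simps)
      then show "?P (scale3 c u)" by (rule exI[of _ "\<lambda>k. c * q k"])
    qed
  qed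
  then show ?thesis
    using that by blast
qed

lemma sum_lessThan_add:
  fixes g :: "nat \<Rightarrow> 'a :: comm_monoid_add"
  shows "(\<Sum>k<a + b. g k) = (\<Sum>k<a. g k) + (\<Sum>k<b. g (a + k))"
  by (induction b) (simp_all add: add.assoc)

context normal_crossing_curve begin

lemma homogeneous3_omega_syz:
  assumes j: "j \<in> {1..m}"
  shows "homogeneous3 (d - 2) (omega_syz j)"
  unfolding omega_syz_eq
proof (rule homogeneous3_sum)
  fix i assume i: "i \<in> {1..m} - {j}"
  have d: "d = e i + (e j + sum e ({1..m} - {i, j}))"
  proof -
    have "{1..m} - {i} - {j} = {1..m} - {i, j}"
      by blast
    then show ?thesis
      unfolding d_def using i j by (simp add: sum.remove[of _ i] sum.remove[of _ j])
  qed
  have div: "f div (F i * F j) = (\<Prod>k\<in>{1..m}-{i, j}. F k)"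
    using i j by (intro cofactor_cofactor(1)) auto
  have "homogeneous3 (sum e ({1..m} - {i, j}) + ((e i - 1) + (e j - 1)))
      (scale3 (f div (F i * F j)) (cross (grad i) (grad j)))"
    unfolding div
    by (intro homogeneous3_scale3 homogeneous3_cross homogeneous3_ext_d homogeneous_prod
        homogeneous_F) (use i j in auto)
  moreover have "sum e ({1..m} - {i, j}) + ((e i - 1) + (e j - 1)) = d - 2"
    using e_pos[of i] e_pos[of j] i j unfolding d by simp
  ultimately show "homogeneous3 (d - 2) (scale3 (f div (F i * F j)) (cross (grad i) (grad j)))"
    by simp
qed

lemma F_origin: "j \<in> {1..m} \<Longrightarrow> eval_at (F j) (0, 0, 0) = 0"
  using eval_at_origin_homogeneous homogeneous_F e_pos by blast

text \<open>
If a generator were superfluous, there would be a relation in which its coefficient is \<open>- 1\<close>.  Evaluate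
the conclusion of \<open>relation_structure\<close> at the origin, where all \<open>F j\<close> vanish: the coefficients of all
\<open>\<omega>\<^sub>j\<close>, \<open>j \<le> m\<close>, have the same value there, and this value is \<open>0\<close> because \<open>\<omega>\<^sub>m\<close> does not occur.  The
coefficients of the \<open>df \<and> T ! i\<close> vanish at the origin by assumption.
\<close>

lemma has_exponents_if_independent:
  fixes T :: "S3 list"
  assumes T: "\<And>t. t \<in> set T \<Longrightarrow> homogeneous3 0 t"
    and span: "S3.span (omega_syz ` {1..m-1} \<union> cross (ext_d f) ` set T) = D0 f"
    and indep: "\<And>k b i. (\<Sum>j\<in>{1..m}. scale3 (k j) (grad j)) + (\<Sum>i<length T. scale3 (b i) (T ! i)) = 0
      \<Longrightarrow> i < length T \<Longrightarrow> eval_at (b i) (0, 0, 0) = 0"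
  shows "has_exponents f (replicate (m - 1) (d - 2) @ replicate (length T) (d - 1))"
proof -
  define rs where "rs = map omega_syz [1..<m] @ map (cross (ext_d f)) T"
  define ds where "ds = replicate (m - 1) (d - 2) @ replicate (length T) (d - 1)"
  have len: "length rs = m - 1 + length T" "length ds = m - 1 + length T"
    by (simp_all add: rs_def ds_def)
  have rs_omega: "rs ! i = omega_syz (Suc i)" if "i < m - 1" for i
    using that by (simp add: rs_def nth_append)
  have rs_T: "rs ! (m - 1 + i) = cross (ext_d f) (T ! i)" if "i < length T" for i
    using that by (simp add: rs_def nth_append)
  have "set [1..<m] = {1..m-1}"
    by auto
  then have set_rs: "S3.span (set rs) = D0 f"
    using span by (simp add: rs_def)
  have hom: "homogeneous3 (ds ! i) (rs ! i)" if i: "i < length ds" for i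
  proof (cases "i < m - 1")
    case True
    then show ?thesis
      using homogeneous3_omega_syz[of "Suc i"] by (simp add: rs_omega ds_def nth_append)
  next
    case False
    then obtain i' where i': "i = m - 1 + i'"
      by (metis le_add_diff_inverse not_le)
    then have "i' < length T"
      using i len by simp
    moreover have "homogeneous3 (d - 1 + 0) (cross (ext_d f) (T ! i'))"
      using \<open>i' < length T\<close> by (intro homogeneous3_cross homogeneous3_ext_d homogeneous_f T) simp
    ultimately show ?thesis
      using rs_T[of i'] by (simp add: i' ds_def nth_append)
  qed
  have minimal: "S3.span {rs ! k | k. k < length ds \<and> k \<noteq> i} \<noteq> D0 f" if i: "i < length ds" for i
  proof
    let ?n = "m - 1 + length T"
    assume "S3.span {rs ! k | k. k < length ds \<and> k \<noteq> i} = D0 f"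
    moreover have "{rs ! k | k. k < length ds \<and> k \<noteq> i} = (!) rs ` ({..<?n} - {i})"
      using len by auto
    moreover have "rs ! i \<in> D0 f"
      using i len set_rs S3.span_base[of "rs ! i" "set rs"] by simp
    ultimately have "rs ! i \<in> S3.span ((!) rs ` ({..<?n} - {i}))"
      by simp
    then obtain q' where q': "rs ! i = (\<Sum>k\<in>{..<?n} - {i}. scale3 (q' k) (rs ! k))"
      using span_image_combination[of "{..<?n} - {i}"] by blast
    define q where "q k = (if k = i then - 1 else q' k)" for k
    have neg: "scale3 (- 1) v = - v" for v
      by (cases v) simp
    have "(\<Sum>k<?n. scale3 (q k) (rs ! k))
        = scale3 (q i) (rs ! i) + (\<Sum>k\<in>{..<?n} - {i}. scale3 (q k) (rs ! k))"
      using i len by (intro sum.remove) auto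
    also have "(\<Sum>k\<in>{..<?n} - {i}. scale3 (q k) (rs ! k)) = rs ! i"
      unfolding q' by (intro sum.cong) (auto simp: q_def)
    finally have "(\<Sum>k<?n. scale3 (q k) (rs ! k)) = 0"
      by (simp add: q_def neg)
    then have sum0: "(\<Sum>k<m-1. scale3 (q k) (omega_syz (Suc k)))
        + (\<Sum>k<length T. scale3 (q (m - 1 + k)) (cross (ext_d f) (T ! k))) = 0"
      unfolding sum_lessThan_add by (simp add: rs_omega rs_T[unfolded One_nat_def])
    define a where "a j = (if j < m then q (j - 1) else 0)" for j
    define \<tau> where "\<tau> = (\<Sum>k<length T. scale3 (q (m - 1 + k)) (T ! k))"
    have m_eq: "{1..m} = insert m {1..m-1}"
      using m_pos by auto
    have "(\<Sum>j\<in>{1..m}. scale3 (a j) (omega_syz j)) = (\<Sum>j\<in>{1..m-1}. scale3 (q (j - 1)) (omega_syz j))"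
      unfolding m_eq using m_pos by (subst sum.insert) (auto simp: a_def scale3_simps intro!: sum.cong)
    also have "\<dots> = (\<Sum>k<m-1. scale3 (q k) (omega_syz (Suc k)))"
      by (rule sum.reindex_bij_witness[of _ Suc "\<lambda>j. j - 1"]) auto
    finally have "(\<Sum>j\<in>{1..m}. scale3 (a j) (omega_syz j)) + cross (ext_d f) \<tau> = 0"
      using sum0 by (simp add: \<tau>_def cross_sum cross_simps)
    then obtain h k where hk: "\<And>j. j \<in> {1..m} \<Longrightarrow> a j = h + F j * k j"
        "(\<Sum>j\<in>{1..m}. scale3 (k j) (grad j)) + \<tau> = 0"
      using relation_structure by blast
    show False
    proof (cases "i < m - 1")
      case True
      have a_origin: "eval_at (a j) (0, 0, 0) = eval_at h (0, 0, 0)" if "j \<in> {1..m}" for j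
        using hk(1)[OF that] F_origin[OF that] by simp
      have "a m = 0" "a (Suc i) = - 1"
        using True by (simp_all add: a_def q_def)
      moreover have "m \<in> {1..m}" "Suc i \<in> {1..m}"
        using True m_pos by auto
      ultimately show False
        using a_origin[of m] a_origin[of "Suc i"] by simp
    next
      case False
      then obtain i' where i': "i = m - 1 + i'"
        by (metis le_add_diff_inverse not_le)
      then have "eval_at (q (m - 1 + i')) (0, 0, 0) = 0"
        using i len by (intro indep[OF hk(2)[unfolded \<tau>_def]]) simp
      then show False
        by (simp add: q_def i')
    qed
  qed
  have "sorted ds"
    unfolding ds_def by (auto simp: sorted_append)
  then show ?thesis
    unfolding has_exponents_def ds_def[symmetric]
    by (intro conjI exI[of _ rs] allI impI hom minimal set_rs) (simp_all add: len)
qed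

end

subsection \<open>Bases of constant one-forms\<close>

fun det3 :: "point \<Rightarrow> point \<Rightarrow> point \<Rightarrow> complex" where
  "det3 (u1, u2, u3) (v1, v2, v3) (w1, w2, w3) =
     u1 * (v2 * w3 - v3 * w2) + u2 * (v3 * w1 - v1 * w3) + u3 * (v1 * w2 - v2 * w1)"

fun const3 :: "point \<Rightarrow> S3" where
  "const3 (a, b, c) = (scalar a, scalar b, scalar c)"

abbreviation (input) e1 :: point where "e1 \<equiv> (1, 0, 0)"
abbreviation (input) e2 :: point where "e2 \<equiv> (0, 1, 0)"
abbreviation (input) e3 :: point where "e3 \<equiv> (0, 0, 1)"

lemma homogeneous_scalar: "homogeneous 0 (scalar a)"
  by (simp add: homogeneous_def scalar_def coeff_pCons split: nat.splits)

lemma homogeneous3_const3: "homogeneous3 0 (const3 t)"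
  by (cases t) (simp add: homogeneous_scalar)

text \<open>
Cramer's rule.
\<close>

lemma det3_relation:
  assumes "det3 (u1, u2, u3) (v1, v2, v3) (w1, w2, w3) \<noteq> 0"
    and rel: "a * u1 + b * v1 + c * w1 = 0" "a * u2 + b * v2 + c * w2 = 0"
      "a * u3 + b * v3 + c * w3 = 0"
  shows "a = 0" "b = 0" "c = 0"
proof -
  let ?D = "det3 (u1, u2, u3) (v1, v2, v3) (w1, w2, w3)"
  have "?D * a = (a * u1 + b * v1 + c * w1) * (v2 * w3 - v3 * w2)
      + (a * u2 + b * v2 + c * w2) * (v3 * w1 - v1 * w3)
      + (a * u3 + b * v3 + c * w3) * (v1 * w2 - v2 * w1)"
    "?D * b = (a * u1 + b * v1 + c * w1) * (w2 * u3 - w3 * u2)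
      + (a * u2 + b * v2 + c * w2) * (w3 * u1 - w1 * u3)
      + (a * u3 + b * v3 + c * w3) * (w1 * u2 - w2 * u1)"
    "?D * c = (a * u1 + b * v1 + c * w1) * (u2 * v3 - u3 * v2)
      + (a * u2 + b * v2 + c * w2) * (u3 * v1 - u1 * v3)
      + (a * u3 + b * v3 + c * w3) * (u1 * v2 - u2 * v1)"
    by (simp_all add: algebra_simps)
  then show "a = 0" "b = 0" "c = 0"
    using assms(1) unfolding rel by simp_all
qed

text \<open>
\<open>v\<close> and \<open>w\<close> can be taken from the standard basis.
\<close>

lemma complete_basis_1:
  assumes "u \<noteq> (0, 0, 0)"
  obtains v w where "det3 u v w \<noteq> 0"
proof -
  obtain u1 u2 u3 where u: "u = (u1, u2, u3)" by (cases u)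
  have "det3 u e2 e3 = u1" "det3 u e3 e1 = u2" "det3 u e1 e2 = u3"
    by (simp_all add: u)
  then show ?thesis
    using assms that u by (metis (no_types))
qed

lemma complete_basis_2:
  assumes "u2 * v3 \<noteq> u3 * v2 \<or> u3 * v1 \<noteq> u1 * v3 \<or> u1 * v2 \<noteq> u2 * v1"
  obtains w where "det3 (u1, u2, u3) (v1, v2, v3) w \<noteq> 0"
proof -
  let ?u = "(u1, u2, u3)" and ?v = "(v1, v2, v3)"
  have "det3 ?u ?v e1 = u2 * v3 - u3 * v2" "det3 ?u ?v e2 = u3 * v1 - u1 * v3"
    "det3 ?u ?v e3 = u1 * v2 - u2 * v1"
    by (simp_all add: algebra_simps)
  then show ?thesis
    using assms that by (metis right_minus_eq)
qed

lemma cross_const3_span: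
  assumes N: "S3.subspace N" and D: "det3 u v w \<noteq> 0"
    and mem: "cross g (const3 u) \<in> N" "cross g (const3 v) \<in> N" "cross g (const3 w) \<in> N"
  shows "cross g (const3 t) \<in> N"
proof -
  obtain u1 u2 u3 where u: "u = (u1, u2, u3)" by (cases u)
  obtain v1 v2 v3 where v: "v = (v1, v2, v3)" by (cases v)
  obtain w1 w2 w3 where w: "w = (w1, w2, w3)" by (cases w)
  obtain t1 t2 t3 where t: "t = (t1, t2, t3)" by (cases t)
  define \<delta> where "\<delta> = det3 u v w"
  define a b c where abc: "a = det3 t v w / \<delta>" "b = det3 u t w / \<delta>" "c = det3 u v t / \<delta>"
  have "\<delta> \<noteq> 0"
    using D by (simp add: \<delta>_def)
  have cramer: "t1 = a * u1 + b * v1 + c * w1" "t2 = a * u2 + b * v2 + c * w2"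
    "t3 = a * u3 + b * v3 + c * w3"
  proof -
    have "\<delta> * t1 = det3 t v w * u1 + det3 u t w * v1 + det3 u v t * w1"
      "\<delta> * t2 = det3 t v w * u2 + det3 u t w * v2 + det3 u v t * w2"
      "\<delta> * t3 = det3 t v w * u3 + det3 u t w * v3 + det3 u v t * w3"
      by (simp_all add: \<delta>_def u v w t algebra_simps)
    then show "t1 = a * u1 + b * v1 + c * w1" "t2 = a * u2 + b * v2 + c * w2"
      "t3 = a * u3 + b * v3 + c * w3"
      using \<open>\<delta> \<noteq> 0\<close> unfolding abc by (simp_all add: field_simps)
  qed
  have "const3 t = scale3 (scalar a) (const3 u) + scale3 (scalar b) (const3 v)
      + scale3 (scalar c) (const3 w)"
    unfolding u v w t by (simp add: cramer)
  then have "cross g (const3 t) = scale3 (scalar a) (cross g (const3 u))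
      + scale3 (scalar b) (cross g (const3 v)) + scale3 (scalar c) (cross g (const3 w))"
    by (simp add: cross_simps)
  then show ?thesis
    using mem by (simp add: S3.subspace_add[OF N] S3.subspace_scale[OF N])
qed

context normal_crossing_curve begin

abbreviation origin :: point where "origin \<equiv> (0, 0, 0)"

lemma line_gradient:
  assumes j: "j \<in> {1..m}" and line: "e j = 1"
  shows "grad j = const3 (gradient_at j P)" and "gradient_at j P \<noteq> (0, 0, 0)"
proof -
  have "homogeneous 0 (partial_x (F j))" "homogeneous 0 (partial_y (F j))"
      "homogeneous 0 (partial_z (F j))"
    using homogeneous_partial[OF homogeneous_F[OF j]] line by simp_all
  then obtain a b c where abc: "partial_x (F j) = scalar a" "partial_y (F j) = scalar b"
      "partial_z (F j) = scalar c"
    by (metis homogeneous_degree_0)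
  then show grad: "grad j = const3 (gradient_at j P)"
    by (simp add: gradient_at_def ext_d_def)
  have "\<not> dvd3 (F j) (grad j)"
    using exists_partial_not_divisible[OF prime_F[OF j] homogeneous_F[OF j] e_pos[OF j]] .
  then show "gradient_at j P \<noteq> (0, 0, 0)"
    unfolding grad by (auto simp: dvd3_iff)
qed

lemma line_eval_at:
  assumes j: "j \<in> {1..m}" and line: "e j = 1" and g: "gradient_at j P = (a, b, c)"
  shows "eval_at (F j) (p1, p2, p3) = p1 * a + p2 * b + p3 * c"
proof -
  have "F j = xvar * scalar a + yvar * scalar b + zvar * scalar c"
    using euler[OF homogeneous_F[OF j]] line_gradient(1)[OF j line, of P] line
    by (simp add: ext_d_def g)
  then show ?thesis by simp
qed

lemma nonline_gradient:
  assumes j: "j \<in> {1..m}" and nonline: "e j \<noteq> 1"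
  shows "gradient_at j origin = (0, 0, 0)"
proof -
  have "e j - 1 > 0"
    using e_pos[OF j] nonline by simp
  then show ?thesis
    using homogeneous_partial[OF homogeneous_F[OF j]] eval_at_origin_homogeneous
    by (simp add: gradient_at_def)
qed

lemma line_gradient_at_eq:
  assumes "j \<in> {1..m}" and "e j = 1"
  shows "gradient_at j P = gradient_at j Q"
proof -
  obtain a b c a' b' c' where abc: "gradient_at j P = (a, b, c)" "gradient_at j Q = (a', b', c')"
    by (metis prod_cases3)
  show ?thesis
    using line_gradient(1)[OF assms, of P] line_gradient(1)[OF assms, of Q] unfolding abc by simp
qed

text \<open>
Two different lines meet in a point of the plane, and normal crossings make their gradients
independent there; the gradients are constant.
\<close>

lemma two_lines:
  assumes ij: "i \<in> {1..m}" "j \<in> {1..m}" "i \<noteq> j" and lines: "e i = 1" "e j = 1"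
  obtains w where "det3 (gradient_at i origin) (gradient_at j origin) w \<noteq> 0"
proof -
  obtain u1 u2 u3 where u: "gradient_at i origin = (u1, u2, u3)" by (cases "gradient_at i origin")
  obtain v1 v2 v3 where v: "gradient_at j origin = (v1, v2, v3)" by (cases "gradient_at j origin")
  have "u2 * v3 \<noteq> u3 * v2 \<or> u3 * v1 \<noteq> u1 * v3 \<or> u1 * v2 \<noteq> u2 * v1"
  proof (rule ccontr)
    assume "\<not> ?thesis"
    then have minors: "u2 * v3 = u3 * v2" "u3 * v1 = u1 * v3" "u1 * v2 = u2 * v1"
      by blast+
    have u0: "u1 \<noteq> 0 \<or> u2 \<noteq> 0 \<or> u3 \<noteq> 0"
      using line_gradient(2)[OF ij(1) lines(1), of origin] by (auto simp: u)
    define P :: point where "P = (if u1 = 0 \<and> u2 = 0 then (1, 0, 0) else (u2, - u1, 0))"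
    have P: "P \<noteq> (0, 0, 0)"
      by (auto simp: P_def)
    have "eval_at (F i) P = 0" "eval_at (F j) P = 0"
      using minors u0 line_eval_at[OF ij(1) lines(1) u] line_eval_at[OF ij(2) lines(2) v]
      by (auto simp: P_def mult.commute)
    moreover have "gradient_at i P = (u1, u2, u3)" "gradient_at j P = (v1, v2, v3)"
      using u v line_gradient_at_eq ij lines by metis+
    ultimately show False
      using transversal[OF P ij _ _ _ _ minors] by blast
  qed
  then show ?thesis
    using complete_basis_2 that u v by metis
qed

text \<open>
The cross product of two of the gradients is the point where these two lines meet, and the
determinant is the value of the third linear form there.
\<close>

lemma three_lines:
  assumes ijk: "i \<in> {1..m}" "j \<in> {1..m}" "k \<in> {1..m}" "i \<noteq> j" "i \<noteq> k" "j \<noteq> k"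
    and lines: "e i = 1" "e j = 1" "e k = 1"
  shows "det3 (gradient_at i origin) (gradient_at j origin) (gradient_at k origin) \<noteq> 0"
proof
  assume D: "det3 (gradient_at i origin) (gradient_at j origin) (gradient_at k origin) = 0"
  obtain u1 u2 u3 where u: "gradient_at i origin = (u1, u2, u3)" by (cases "gradient_at i origin")
  obtain v1 v2 v3 where v: "gradient_at j origin = (v1, v2, v3)" by (cases "gradient_at j origin")
  obtain w1 w2 w3 where w: "gradient_at k origin = (w1, w2, w3)" by (cases "gradient_at k origin")
  define P where "P = (u2 * v3 - u3 * v2, u3 * v1 - u1 * v3, u1 * v2 - u2 * v1)"
  have "eval_at (F i) P = 0" "eval_at (F j) P = 0"
    unfolding P_def line_eval_at[OF ijk(1) lines(1) u] line_eval_at[OF ijk(2) lines(2) v]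
    by (simp_all add: algebra_simps)
  moreover have "eval_at (F k) P = det3 (gradient_at i origin) (gradient_at j origin) (gradient_at k origin)"
    unfolding P_def line_eval_at[OF ijk(3) lines(3) w] u v w by (simp add: algebra_simps)
  ultimately have "P = (0, 0, 0)"
    using no_triple_point[OF ijk] D by simp
  moreover obtain w' where "det3 (gradient_at i origin) (gradient_at j origin) w' \<noteq> 0"
    using two_lines[OF ijk(1,2,4) lines(1,2)] .
  moreover obtain x1 x2 x3 where "w' = (x1, x2, x3)" by (cases w')
  moreover have "det3 (u1, u2, u3) (v1, v2, v3) (x1, x2, x3)
      = x1 * (u2 * v3 - u3 * v2) + x2 * (u3 * v1 - u1 * v3) + x3 * (u1 * v2 - u2 * v1)" for x1 x2 x3
    by (simp add: algebra_simps)
  ultimately show False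
    by (simp add: P_def u v)
qed

lemma line_form_in_span:
  assumes N: "S3.subspace N" and omega_syz: "omega_syz ` {1..m-1} \<subseteq> N" and j: "j \<in> {1..m}" and line: "e j = 1"
  shows "cross (ext_d f) (const3 (gradient_at j P)) \<in> N"
  unfolding line_gradient(1)[OF j line, of P, symmetric] F_mult_omega_syz[OF j, symmetric]
  by (intro S3.subspace_scale[OF N] omega_syz_mem_subspace[OF N omega_syz j])

text \<open>
The constant gradients of the lines \<open>js\<close> and the vectors \<open>ts\<close> form a basis of \<open>\<complex>\<^sup>3\<close>.  Being a spanning
set gives generation, because \<open>df \<and> df\<^sub>j\<close> is a multiple of \<open>\<omega>\<^sub>j\<close>.  Being independent gives minimality:
in a relation \<open>\<Sum> k\<^sub>j df\<^sub>j + \<Sum> b\<^sub>i ts\<^sub>i = 0\<close>, evaluated at the origin, only the \<open>df\<^sub>j\<close> of the lines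
survive, and therefore all \<open>b\<^sub>i\<close> vanish there.
\<close>

lemma exponents_of_basis:
  assumes js: "set js \<subseteq> {j \<in> {1..m}. e j = 1}" "distinct js"
    and all_lines: "ts \<noteq> [] \<Longrightarrow> set js = {j \<in> {1..m}. e j = 1}"
    and basis: "map (\<lambda>j. gradient_at j origin) js @ ts = [u, v, w]" "det3 u v w \<noteq> 0"
  shows "S3.span (omega_syz ` {1..m-1} \<union> cross (ext_d f) ` const3 ` set ts) = D0 f"
    and "has_exponents f (replicate (m - 1) (d - 2) @ replicate (length ts) (d - 1))"
proof -
  show span: "S3.span (omega_syz ` {1..m-1} \<union> cross (ext_d f) ` const3 ` set ts) = D0 f" (is "S3.span ?G = _")
  proof (rule span_eq_D0)
    have N: "S3.subspace (S3.span ?G)"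
      by (rule S3.subspace_span)
    have omega_N: "omega_syz ` {1..m-1} \<subseteq> S3.span ?G"
      by (auto intro: S3.span_base)
    have mem: "cross (ext_d f) (const3 t) \<in> S3.span ?G" if "t \<in> {u, v, w}" for t
    proof -
      have "t \<in> set (map (\<lambda>j. gradient_at j origin) js @ ts)"
        using that unfolding basis(1) by simp
      then consider "t \<in> set ts" | j where "j \<in> set js" "t = gradient_at j origin"
        by auto
      then show ?thesis
      proof cases
        case 1
        then show ?thesis by (auto intro: S3.span_base)
      next
        case 2
        then show ?thesis
          using line_form_in_span[OF N omega_N, of j origin] js(1) by auto
      qed
    qed
    fix x :: S3 assume "x \<in> {(1, 0, 0), (0, 1, 0), (0, 0, 1)}"
    then have "x \<in> const3 ` {e1, e2, e3}"
      by simp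
    then obtain t where "x = const3 t"
      by blast
    moreover have "cross (ext_d f) (const3 t) \<in> S3.span ?G"
      by (rule cross_const3_span[OF N basis(2)]; rule mem) simp_all
    ultimately show "cross (ext_d f) x \<in> S3.span ?G"
      by simp
  qed
  have "has_exponents f (replicate (m - 1) (d - 2) @ replicate (length (map const3 ts)) (d - 1))"
  proof (rule has_exponents_if_independent)
    show "homogeneous3 0 t" if "t \<in> set (map const3 ts)" for t
      using that homogeneous3_const3 by auto
    show "S3.span (omega_syz ` {1..m-1} \<union> cross (ext_d f) ` set (map const3 ts)) = D0 f"
      using span by simp
    fix k b i
    assume rel: "(\<Sum>j\<in>{1..m}. scale3 (k j) (grad j))
        + (\<Sum>i<length (map const3 ts). scale3 (b i) (map const3 ts ! i)) = 0"
      and i: "i < length (map const3 ts)"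
    have "ts \<noteq> []"
      using i by auto
    then have lines: "set js = {j \<in> {1..m}. e j = 1}"
      by (rule all_lines)
    define \<kappa> where "\<kappa> j = eval_at (k j) origin" for j
    define \<tau> where "\<tau> i = eval_at (b i) origin" for i
    define g where "g j = gradient_at j origin" for j
    \<comment> \<open>The three coordinates of the relation at the origin; \<open>\<pi>\<close> and \<open>\<Pi>\<close> are the same projection of
      \<open>\<complex>\<^sup>3\<close> and \<open>S\<^sup>3\<close>.\<close>
    have coord: "(\<Sum>j\<leftarrow>js. \<kappa> j * \<pi> (g j)) + (\<Sum>i<length ts. \<tau> i * \<pi> (ts ! i)) = 0"
      if pi: "(\<pi>, \<Pi>) \<in> {(fst, fst), (fst \<circ> snd, fst \<circ> snd), (snd \<circ> snd, snd \<circ> snd)}"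
      for \<pi> :: "point \<Rightarrow> complex" and \<Pi> :: "S3 \<Rightarrow> S"
    proof -
      have add: "\<Pi> (x + y) = \<Pi> x + \<Pi> y" for x y
        using pi by auto
      have zero: "\<Pi> 0 = 0" and pi0: "\<pi> (0, 0, 0) = 0"
        using pi by auto
      have scale: "\<Pi> (scale3 s x) = s * \<Pi> x" for s x
        using pi by (cases x) auto
      have const: "eval_at (\<Pi> (const3 t)) origin = \<pi> t" for t
        using pi by (cases t) auto
      have gradient: "eval_at (\<Pi> (grad j)) origin = \<pi> (g j)" for j
        using pi by (auto simp: ext_d_def g_def gradient_at_def)
      have sum: "\<Pi> (sum h A) = (\<Sum>i\<in>A. \<Pi> (h i))" for h and A :: "nat set"
        by (induction A rule: infinite_finite_induct) (simp_all add: add zero)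
      have "0 = eval_at (\<Pi> ((\<Sum>j\<in>{1..m}. scale3 (k j) (grad j))
          + (\<Sum>i<length (map const3 ts). scale3 (b i) (map const3 ts ! i)))) origin"
        unfolding rel zero by simp
      also have "\<dots> = (\<Sum>j\<in>{1..m}. \<kappa> j * \<pi> (g j)) + (\<Sum>i<length ts. \<tau> i * \<pi> (ts ! i))"
        by (simp add: add sum scale const gradient \<kappa>_def \<tau>_def)
      also have "(\<Sum>j\<in>{1..m}. \<kappa> j * \<pi> (g j)) = (\<Sum>j\<in>set js. \<kappa> j * \<pi> (g j))"
        using lines nonline_gradient by (intro sum.mono_neutral_right) (auto simp: g_def pi0)
      also have "\<dots> = (\<Sum>j\<leftarrow>js. \<kappa> j * \<pi> (g j))"
        using js(2) by (simp add: sum_list_distinct_conv_sum_set)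
      finally show ?thesis by simp
    qed
    obtain u1 u2 u3 where u: "u = (u1, u2, u3)" by (cases u)
    obtain v1 v2 v3 where v: "v = (v1, v2, v3)" by (cases v)
    obtain w1 w2 w3 where w: "w = (w1, w2, w3)" by (cases w)
    note coords = coord[of fst fst, simplified] coord[of "fst \<circ> snd" "fst \<circ> snd", simplified]
      coord[of "snd \<circ> snd" "snd \<circ> snd", simplified]
    note no_relation = det3_relation[OF basis(2)[unfolded u v w]]
    have b': "map g js @ ts = [u, v, w]"
      using basis(1) by (simp add: g_def[abs_def])
    have "\<tau> i = 0"
    proof (cases js)
      case Nil
      then have ts: "ts = [u, v, w]"
        using b' by simp
      have eqs: "\<tau> 0 * u1 + \<tau> 1 * v1 + \<tau> 2 * w1 = 0" "\<tau> 0 * u2 + \<tau> 1 * v2 + \<tau> 2 * w2 = 0"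
          "\<tau> 0 * u3 + \<tau> 1 * v3 + \<tau> 2 * w3 = 0"
        using coords by (simp_all add: Nil ts u v w lessThan_Suc numeral_eq_Suc ac_simps)
      note zeros = no_relation(1)[OF eqs] no_relation(2)[OF eqs] no_relation(3)[OF eqs]
      have "i = 0 \<or> i = 1 \<or> i = 2"
        using i ts by auto
      then show ?thesis
        using zeros by blast
    next
      case (Cons j1 js1)
      note C1 = this
      show ?thesis
      proof (cases js1)
        case Nil
        then have ts: "ts = [v, w]" "g j1 = u"
          using b' C1 by simp_all
        have eqs: "\<kappa> j1 * u1 + \<tau> 0 * v1 + \<tau> 1 * w1 = 0" "\<kappa> j1 * u2 + \<tau> 0 * v2 + \<tau> 1 * w2 = 0"
            "\<kappa> j1 * u3 + \<tau> 0 * v3 + \<tau> 1 * w3 = 0"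
          using coords by (simp_all add: Nil C1 ts u v w lessThan_Suc ac_simps)
        note zeros = no_relation(2)[OF eqs] no_relation(3)[OF eqs]
        have "i = 0 \<or> i = 1"
          using i ts by auto
        then show ?thesis
          using zeros by blast
      next
        case (Cons j2 js2)
        note C2 = this
        show ?thesis
        proof (cases js2)
          case Nil
          then have ts: "ts = [w]" "g j1 = u" "g j2 = v"
            using b' C1 C2 by simp_all
          have eqs: "\<kappa> j1 * u1 + \<kappa> j2 * v1 + \<tau> 0 * w1 = 0"
              "\<kappa> j1 * u2 + \<kappa> j2 * v2 + \<tau> 0 * w2 = 0" "\<kappa> j1 * u3 + \<kappa> j2 * v3 + \<tau> 0 * w3 = 0"
            using coords by (simp_all add: Nil C1 C2 ts u v w lessThan_Suc ac_simps)
          have "i = 0"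
            using i ts by simp
          then show ?thesis
            using no_relation(3)[OF eqs] by simp
        next
          case (Cons j3 js3)
          then have "ts = []"
            using b' C1 C2 by simp
          then show ?thesis
            using i by simp
        qed
      qed
    qed
    then show "eval_at (b i) (0, 0, 0) = 0"
      by (simp add: \<tau>_def)
  qed
  then show "has_exponents f (replicate (m - 1) (d - 2) @ replicate (length ts) (d - 1))"
    by simp
qed

lemma exponents:
  fixes l :: nat
  defines "l \<equiv> card {j \<in> {1..m}. e j = 1}"
  shows "has_exponents f (replicate (m - 1) (d - 2) @ replicate (3 - l) (d - 1))"
    and "l \<ge> 3 \<Longrightarrow> S3.span (omega_syz ` {1..m-1}) = D0 f"
proof -
  let ?L = "{j \<in> {1..m}. e j = 1}"
  have fin: "finite ?L" by simp
  obtain js where "set js = ?L" "distinct js"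
    using finite_distinct_list[OF fin] by blast
  then have js: "set js = ?L" "distinct js" "length js = l"
    unfolding l_def by (metis distinct_card)+
  define g where "g j = gradient_at j origin" for j
  have "(l \<ge> 3 \<longrightarrow> S3.span (omega_syz ` {1..m-1}) = D0 f) \<and>
    has_exponents f (replicate (m - 1) (d - 2) @ replicate (3 - l) (d - 1))"
  proof (cases "l \<ge> 3")
    case True
    then obtain i j k js' where ijk: "js = i # j # k # js'"
      using js(3) by (cases js; cases "tl js"; cases "tl (tl js)"; simp)
    then have "det3 (g i) (g j) (g k) \<noteq> 0"
      unfolding g_def using js by (intro three_lines) auto
    moreover have "set [i, j, k] \<subseteq> ?L" "distinct [i, j, k]"
      using js ijk by auto
    ultimately show ?thesis
      using exponents_of_basis[of "[i, j, k]" "[]" "g i" "g j" "g k"] True by (simp add: g_def)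
  next
    case False
    then consider "l = 0" | "l = 1" | "l = 2"
      by linarith
    then have "\<exists>ts u v w. map g js @ ts = [u, v, w] \<and> det3 u v w \<noteq> 0"
    proof cases
      case 1
      have "det3 e1 e2 e3 \<noteq> 0" by simp
      moreover have "map g js @ [e1, e2, e3] = [e1, e2, e3]"
        using 1 js(3) by simp
      ultimately show ?thesis by blast
    next
      case 2
      then obtain j where j: "js = [j]"
        using js(3) by (auto simp: length_Suc_conv)
      then have "g j \<noteq> (0, 0, 0)"
        using js(1) line_gradient(2)[of j] unfolding g_def by auto
      then obtain v w where "det3 (g j) v w \<noteq> 0"
        by (rule complete_basis_1)
      moreover have "map g js @ [v, w] = [g j, v, w]"
        using j by simp
      ultimately show ?thesis by blast
    next
      case 3
      then obtain i j where ij: "js = [i, j]"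
        using js(3) by (auto simp: length_Suc_conv numeral_eq_Suc)
      have "i \<in> ?L" "j \<in> ?L" "i \<noteq> j"
        using js ij by auto
      then obtain w where "det3 (g i) (g j) w \<noteq> 0"
        unfolding g_def using two_lines[of i j] by auto
      moreover have "map g js @ [w] = [g i, g j, w]"
        using ij by simp
      ultimately show ?thesis by blast
    qed
    then obtain ts u v w where ts: "map g js @ ts = [u, v, w]" "det3 u v w \<noteq> 0"
      by blast
    have "length ts = 3 - l"
      using arg_cong[OF ts(1), of length] js(3) by simp
    then show ?thesis
      using exponents_of_basis(2)[of js ts u v w] js ts False by (simp add: g_def[abs_def])
  qed
  then show "has_exponents f (replicate (m - 1) (d - 2) @ replicate (3 - l) (d - 1))"
    and "l \<ge> 3 \<Longrightarrow> S3.span (omega_syz ` {1..m-1}) = D0 f"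
    by blast+
qed

lemma generated_by_forms_iff:
  "generated_by_forms f (omega m F ` A \<union> V) \<longleftrightarrow> S3.span (omega_syz ` A \<union> syzygy_of_form ` V) = D0 f"
  unfolding generated_by_forms_def omega_syz_def[abs_def] image_Un image_image ..

end

lemma syzygy_of_omega_xyz:
  "syzygy_of_form (omega_x f) = cross (ext_d f) (1, 0, 0)"
  "syzygy_of_form (omega_y f) = cross (ext_d f) (0, 1, 0)"
  "syzygy_of_form (omega_z f) = cross (ext_d f) (0, 0, 1)"
  and ext_d_xyz: "ext_d xvar = (1, 0, 0)" "ext_d yvar = (0, 1, 0)"
proof -
  show x: "ext_d xvar = (1, 0, 0)" and y: "ext_d yvar = (0, 1, 0)"
    by (simp_all add: ext_d_def partial_x_def partial_y_def partial_z_def xvar_def yvar_def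
        map_poly_pCons pderiv_pCons one_pCons)
  have "ext_d zvar = (0, 0, 1)"
    by (simp add: ext_d_def partial_x_def partial_y_def partial_z_def zvar_def
        map_poly_pCons pderiv_pCons one_pCons)
  with x y show "syzygy_of_form (omega_x f) = cross (ext_d f) (1, 0, 0)"
    "syzygy_of_form (omega_y f) = cross (ext_d f) (0, 1, 0)"
    "syzygy_of_form (omega_z f) = cross (ext_d f) (0, 0, 1)"
    by (simp_all only: omega_x_def omega_y_def omega_z_def syzygy_of_wedge)
qed

theorem theorem1p2:
  fixes m d l :: nat and F :: "nat \<Rightarrow> S" and e :: "nat \<Rightarrow> nat" and f :: S
  assumes m: "m \<ge> 4"
    and homogeneous: "\<And>j. j \<in> {1..m} \<Longrightarrow> homogeneous (e j) (F j)"
    and irreducible: "\<And>j. j \<in> {1..m} \<Longrightarrow> irreducible (F j)"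
    and distinct: "\<And>i j. i \<in> {1..m} \<Longrightarrow> j \<in> {1..m} \<Longrightarrow> i \<noteq> j \<Longrightarrow> \<not> F i dvd F j"
    and smooth: "\<And>j. j \<in> {1..m} \<Longrightarrow> smooth_curve (F j)"
    and normal_crossing: "normal_crossing m F"
    and f_def: "f = curve_poly m F"
    and d_def: "d = (\<Sum>j=1..m. e j)"
    and l_def: "l = card {j \<in> {1..m}. e j = 1}"
  shows
    "(l = 0 \<longrightarrow>
        generated_by_forms f (omega m F ` {1..m-1} \<union> {omega_x f, omega_y f, omega_z f}) \<and>
        has_exponents f (replicate (m - 1) (d - 2) @ replicate 3 (d - 1))) \<and>
     (l = 1 \<longrightarrow>
        (F 1 = xvar \<longrightarrow>
           generated_by_forms f (omega m F ` {1..m-1} \<union> {omega_y f, omega_z f})) \<and>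
        has_exponents f (replicate (m - 1) (d - 2) @ replicate 2 (d - 1))) \<and>
     (l = 2 \<longrightarrow>
        (F 1 = xvar \<and> F 2 = yvar \<longrightarrow>
           generated_by_forms f (omega m F ` {1..m-1} \<union> {omega_z f})) \<and>
        has_exponents f (replicate (m - 1) (d - 2) @ replicate 1 (d - 1))) \<and>
     (l \<ge> 3 \<longrightarrow>
        generated_by_forms f (omega m F ` {1..m-1}) \<and>
        has_exponents f (replicate (m - 1) (d - 2)))"
proof -
  interpret C: normal_crossing_curve m F e
    by unfold_locales (use m homogeneous irreducible distinct smooth normal_crossing in auto)
  have f: "f = C.f" and d: "d = C.d"
    by (simp_all add: f_def d_def curve_poly_def C.f_def C.d_def)
  have gen: "generated_by_forms f (omega m F ` {1..m-1} \<union> V)"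
    if V: "syzygy_of_form ` V = cross (ext_d f) ` T"
      and axes: "\<And>v. v \<in> {(1, 0, 0), (0, 1, 0), (0, 0, 1)} - T \<Longrightarrow>
        \<exists>j\<in>{1..m}. ext_d (F j) = v" for V and T :: "S3 set"
    unfolding f C.generated_by_forms_iff V[unfolded f]
  proof (rule C.span_eq_D0)
    let ?N = "S3.span (C.omega_syz ` {1..m-1} \<union> cross (ext_d C.f) ` T)"
    fix v :: S3 assume v: "v \<in> {(1, 0, 0), (0, 1, 0), (0, 0, 1)}"
    show "cross (ext_d C.f) v \<in> ?N"
    proof (cases "v \<in> T")
      case True
      then show ?thesis by (auto intro: S3.span_base)
    next
      case False
      then obtain j where j: "j \<in> {1..m}" "ext_d (F j) = v"
        using axes v by blast
      have "C.omega_syz j \<in> ?N"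
        by (rule C.omega_syz_mem_subspace[OF S3.subspace_span _ j(1)]) (auto intro: S3.span_base)
      then show ?thesis
        unfolding j(2)[symmetric] C.F_mult_omega_syz[OF j(1), symmetric] by (rule S3.span_scale)
    qed
  qed
  have gen0: "generated_by_forms f (omega m F ` {1..m-1} \<union> {omega_x f, omega_y f, omega_z f})"
    by (rule gen[of _ "{(1, 0, 0), (0, 1, 0), (0, 0, 1)}"]) (simp_all add: syzygy_of_omega_xyz)
  have gen1: "generated_by_forms f (omega m F ` {1..m-1} \<union> {omega_y f, omega_z f})"
    if "F 1 = xvar"
    by (rule gen[of _ "{(0, 1, 0), (0, 0, 1)}"])
      (use m that ext_d_xyz in \<open>auto simp: syzygy_of_omega_xyz intro!: bexI[of _ 1]\<close>)
  have gen2: "generated_by_forms f (omega m F ` {1..m-1} \<union> {omega_z f})"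
    if "F 1 = xvar" "F 2 = yvar"
  proof (rule gen[of _ "{(0, 0, 1)}"])
    fix v :: S3 assume "v \<in> {(1, 0, 0), (0, 1, 0), (0, 0, 1)} - {(0, 0, 1)}"
    then have "ext_d (F 1) = v \<or> ext_d (F 2) = v"
      unfolding that ext_d_xyz by blast
    moreover have "1 \<in> {1..m}" "2 \<in> {1..m}"
      using m by simp_all
    ultimately show "\<exists>j\<in>{1..m}. ext_d (F j) = v"
      by metis
  qed (simp add: syzygy_of_omega_xyz)
  have gen3: "generated_by_forms f (omega m F ` {1..m-1})" if "l \<ge> 3"
    using C.generated_by_forms_iff[of "{1..m-1}" "{}"] C.exponents(2) that
    by (simp add: f l_def)
  have "has_exponents f (replicate (m - 1) (d - 2) @ replicate (3 - l) (d - 1))"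
    unfolding f d l_def by (rule C.exponents)
  then have exps: "has_exponents f (replicate (m - 1) (d - 2) @ replicate r (d - 1))"
    if "r = 3 - l" for r
    using that by simp
  show ?thesis
  proof (intro conjI impI)
    show "has_exponents f (replicate (m - 1) (d - 2))" if "l \<ge> 3"
      using exps[of 0] that by simp
  qed (rule gen0 gen1 gen2 gen3 exps; simp)+
qed

end
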